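(* Let $\{(x_i,y_i)\}_{i=1}^5$ be a configuration in $\mathbb{P}^2\times\mathbb{P}^2$ such that no $3$ of the $x_i$'s are collinear and the $y_i$'s are distinct and on a line $\ell_y$. Let $\omega$ be the conic through $x_1,\dots,x_5$. Let $Z_5$ be the $5\times9$ matrix with rows $x_i^\top\otimes y_i^\top$, and suppose further that no inherited condition for rank drop holds. Then the following are equivalent: (1) The matrix $Z_5$ is rank deficient (i.e. $\operatorname{rank}(Z_5)<5$). (2) For all $c\in\omega\setminus\{x_1,\dots,x_5\}$ there exists a projective transformation $T_c:\mathbb{P}^2\to\mathbb{P}^1$ centered at $c$ such that $T_c(x_i)\sim y_i$ for all $i$. (3) For some $c\in\omega\setminus\{x_1,\dots,x_5\}$ there exists a projective transformation $T_c:\mathbb{P}^2\to\mathbb{P}^1$ centered at $c$ such that $T_c(x_i)\sim y_i$ for all $i$. (4) There exists a cross-ratio preserving isomorphism $F:\omega\to\ell_y$ such that $F(x_i)=y_i$ for all $i$.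
   Context: $\mathbb{P}^n$ is projective space over $\mathbb{C}$; points are represented by nonzero column vectors, $\sim$ means equal up to a nonzero scalar, and $\otimes$ is the Kronecker product. An inherited condition holds if the rows of $Z_5$ indexed by some proper subset of $\{1,\dots,5\}$ are linearly dependent. The line $\ell_y$ is identified with $\mathbb{P}^1$. A projective transformation $T_c:\mathbb{P}^2\to\mathbb{P}^1$ centered at $c$ is the (rational) map given by a rank $2$ matrix of size $2\times3$ whose null space is spanned by $c$. For $p_i\in\mathbb{P}^2$, $[ijl]$ is the determinant of the $3\times 3$ matrix with rows $p_i^\top,p_j^\top,p_l^\top$, and $(p_1,p_2;p_3,p_4;p_5)=\frac{[135][245]}{[145][235]}$. For points $p_1,\dots,p_4$ on a nondegenerate conic $\omega$, the conic cross-ratio is $(p_1,p_2;p_3,p_4)_\omega=(p_1,p_2;p_3,p_4;p)$ for any further point $p\in\omega$ (it does not depend on $p$). For points on a line identified with $\mathbb{P}^1$, $(p_1,p_2;p_3,p_4)=\frac{[13][24]}{[14][23]}$ with $[ij]$ the $2\times 2$ determinant with rows $p_i^\top,p_j^\top$. Cross-ratio preserving means $(p_1,p_2;p_3,p_4)_\omega=(F(p_1),F(p_2);F(p_3),F(p_4))$. *)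

theory Defs
  imports "HOL-Analysis.Analysis"
begin

section \<open>Projective space over the complex numbers\<close>

definition proj_rel :: "complex^'n \<Rightarrow> complex^'n \<Rightarrow> bool"
  where "proj_rel v w \<longleftrightarrow> v \<noteq> 0 \<and> w \<noteq> 0 \<and> (\<exists>k. k \<noteq> 0 \<and> w = k *s v)"

lemma part_equivp_proj_rel: "part_equivp (proj_rel :: complex^'n::finite \<Rightarrow> _)"
proof (rule part_equivpI)
  have "proj_rel (1 :: complex^'n) 1"
    unfolding proj_rel_def by (auto intro!: exI[of _ 1] simp: vec_eq_iff)
  then show "\<exists>v :: complex^'n. proj_rel v v" ..
  show "symp (proj_rel :: complex^'n \<Rightarrow> _)"
  proof (rule sympI)
    fix v w :: "complex^'n" assume "proj_rel v w"
    then obtain k where k: "k \<noteq> 0" "w = k *s v" "v \<noteq> 0" "w \<noteq> 0"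
      unfolding proj_rel_def by auto
    then have "v = inverse k *s w" by (simp add: vector_smult_assoc)
    then show "proj_rel w v" using k unfolding proj_rel_def
      by (auto intro!: exI[of _ "inverse k"])
  qed
  show "transp (proj_rel :: complex^'n \<Rightarrow> _)"
  proof (rule transpI)
    fix u v w :: "complex^'n" assume "proj_rel u v" "proj_rel v w"
    then obtain k l where "k \<noteq> 0" "v = k *s u" "l \<noteq> 0" "w = l *s v" "u \<noteq> 0" "w \<noteq> 0"
      unfolding proj_rel_def by auto
    then show "proj_rel u w" unfolding proj_rel_def
      by (auto intro!: exI[of _ "l * k"] simp: vector_smult_assoc)
  qed
qed

text \<open>The type \<open>(n+1) proj\<close> is n-dimensional projective space; \<open>pt v\<close> is the point
  represented by the nonzero vector \<open>v\<close>. The value \<open>pt 0\<close> is a meaningless default.\<close>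

quotient_type 'n proj = "complex^'n::finite" / partial: proj_rel
  morphisms rep_pt pt
  by (rule part_equivp_proj_rel)

section \<open>Lines and conics in the projective plane\<close>

definition is_line :: "3 proj set \<Rightarrow> bool"
  where "is_line L \<longleftrightarrow>
    (\<exists>a :: complex^3. a \<noteq> 0 \<and> L = {pt v |v. v \<noteq> 0 \<and> (\<Sum>i\<in>UNIV. a $ i * v $ i) = 0})"

definition proj_collinear :: "3 proj set \<Rightarrow> bool"
  where "proj_collinear S \<longleftrightarrow> (\<exists>L. is_line L \<and> S \<subseteq> L)"

text \<open>Degenerate conics are allowed here; a conic through five points of which no three
  are collinear is automatically nondegenerate.\<close>

definition is_conic :: "3 proj set \<Rightarrow> bool"
  where "is_conic C \<longleftrightarrow>
    (\<exists>Q :: complex^3^3. transpose Q = Q \<and> Q \<noteq> 0 \<and>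
       C = {pt v |v. v \<noteq> 0 \<and> (\<Sum>i\<in>UNIV. v $ i * (Q *v v) $ i) = 0})"

text \<open>An identification of a line in the plane with the projective line, i.e. a projective
  isomorphism onto the line, induced by an injective linear map.\<close>

definition line_identification :: "3 proj set \<Rightarrow> (2 proj \<Rightarrow> 3 proj) \<Rightarrow> bool"
  where "line_identification L \<iota> \<longleftrightarrow>
    (\<exists>B :: complex^2^3. rank B = 2 \<and> (\<forall>u. u \<noteq> 0 \<longrightarrow> \<iota> (pt u) = pt (B *v u))) \<and> range \<iota> = L"

text \<open>The 2-by-3 matrix \<open>T\<close> represents a projective transformation centered at \<open>c\<close>.
  The induced map \<open>pt v \<mapsto> pt (T *v v)\<close> is defined away from \<open>c\<close>.\<close>

definition centered_at :: "3 proj \<Rightarrow> complex^3^2 \<Rightarrow> bool"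
  where "centered_at c T \<longleftrightarrow>
    rank T = 2 \<and> (\<exists>v. v \<noteq> 0 \<and> c = pt v \<and> {w. T *v w = 0} = vec.span {v})"

section \<open>Cross-ratios\<close>

definition bracket2 :: "complex^2 \<Rightarrow> complex^2 \<Rightarrow> complex"
  where "bracket2 p q = det (vector [p, q] :: complex^2^2)"

definition bracket3 :: "complex^3 \<Rightarrow> complex^3 \<Rightarrow> complex^3 \<Rightarrow> complex"
  where "bracket3 p q r = det (vector [p, q, r] :: complex^3^3)"

lemma bracket2_scale:
  "bracket2 (k *s p) q = k * bracket2 p q"
  "bracket2 p (k *s q) = k * bracket2 p q"
  by (simp_all add: bracket2_def det_2 algebra_simps)

lemma bracket3_scale:
  "bracket3 (k *s p) q r = k * bracket3 p q r"
  "bracket3 p (k *s q) r = k * bracket3 p q r"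
  "bracket3 p q (k *s r) = k * bracket3 p q r"
  by (simp_all add: bracket3_def det_3 algebra_simps)

lift_definition cross_ratio :: "2 proj \<Rightarrow> 2 proj \<Rightarrow> 2 proj \<Rightarrow> 2 proj \<Rightarrow> complex"
  is "\<lambda>p1 p2 p3 p4. (bracket2 p1 p3 * bracket2 p2 p4) / (bracket2 p1 p4 * bracket2 p2 p3)"
  by (auto simp: proj_rel_def bracket2_scale)

lift_definition plane_cross_ratio ::
    "3 proj \<Rightarrow> 3 proj \<Rightarrow> 3 proj \<Rightarrow> 3 proj \<Rightarrow> 3 proj \<Rightarrow> complex"
  is "\<lambda>p1 p2 p3 p4 p5. (bracket3 p1 p3 p5 * bracket3 p2 p4 p5) /
                         (bracket3 p1 p4 p5 * bracket3 p2 p3 p5)"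
  by (auto simp: proj_rel_def bracket3_scale)

text \<open>The common value of the plane cross-ratios with respect to all further points of the conic.\<close>

definition conic_cross_ratio ::
    "3 proj set \<Rightarrow> 3 proj \<Rightarrow> 3 proj \<Rightarrow> 3 proj \<Rightarrow> 3 proj \<Rightarrow> complex"
  where "conic_cross_ratio C p1 p2 p3 p4 =
    (THE r. \<forall>p \<in> C - {p1, p2, p3, p4}. plane_cross_ratio p1 p2 p3 p4 p = r)"

text \<open>The cross-ratio on the line is computed through its identification \<open>\<iota>\<close> with the
  projective line. As usual, cross-ratios are only considered for four distinct points.\<close>

definition cross_ratio_preserving ::
    "3 proj set \<Rightarrow> (2 proj \<Rightarrow> 3 proj) \<Rightarrow> (3 proj \<Rightarrow> 3 proj) \<Rightarrow> bool"
  where "cross_ratio_preserving C \<iota> F \<longleftrightarrow>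
    (\<forall>p1\<in>C. \<forall>p2\<in>C. \<forall>p3\<in>C. \<forall>p4\<in>C. distinct [p1, p2, p3, p4] \<longrightarrow>
       conic_cross_ratio C p1 p2 p3 p4 =
       cross_ratio (inv \<iota> (F p1)) (inv \<iota> (F p2)) (inv \<iota> (F p3)) (inv \<iota> (F p4)))"

section \<open>Isomorphisms of projective varieties\<close>

text \<open>Homogeneous polynomial functions of degree \<open>d\<close>; the sum runs over exponent vectors.\<close>

definition is_form :: "nat \<Rightarrow> (complex^'n::finite \<Rightarrow> complex) \<Rightarrow> bool"
  where "is_form d f \<longleftrightarrow>
    (\<exists>a. \<forall>v. f v = (\<Sum>\<alpha> | (\<Sum>i\<in>UNIV. \<alpha> i) = d. a \<alpha> * (\<Prod>i\<in>UNIV. v $ i ^ \<alpha> i)))"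

lemma finite_exponents: "finite {\<alpha> :: 'n::finite \<Rightarrow> nat. (\<Sum>i\<in>UNIV. \<alpha> i) = d}"
proof (rule finite_subset)
  show "{\<alpha> :: 'n \<Rightarrow> nat. (\<Sum>i\<in>UNIV. \<alpha> i) = d} \<subseteq> PiE UNIV (\<lambda>_. {..d})"
    by (auto intro: member_le_sum)
qed (auto intro: finite_PiE)

text \<open>Around each point of \<open>X\<close>, a morphism is given by forms of equal degree without common
  zero at that point.\<close>

definition proj_morphism :: "'n::finite proj set \<Rightarrow> ('n proj \<Rightarrow> 'm::finite proj) \<Rightarrow> bool"
  where "proj_morphism X F \<longleftrightarrow>
    (\<forall>p\<in>X. \<exists>d (f :: complex^'n \<Rightarrow> complex^'m).
       (\<forall>j. is_form d (\<lambda>v. f v $ j)) \<and>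
       (\<exists>v. v \<noteq> 0 \<and> p = pt v \<and> f v \<noteq> 0) \<and>
       (\<forall>v. v \<noteq> 0 \<and> pt v \<in> X \<and> f v \<noteq> 0 \<longrightarrow> F (pt v) = pt (f v)))"

definition proj_isomorphism ::
    "'n::finite proj set \<Rightarrow> 'm::finite proj set \<Rightarrow> ('n proj \<Rightarrow> 'm proj) \<Rightarrow> bool"
  where "proj_isomorphism X Y F \<longleftrightarrow>
    bij_betw F X Y \<and> proj_morphism X F \<and> proj_morphism Y (inv_into X F)"

section \<open>The matrix of Kronecker products\<close>

text \<open>The nine coordinates of a Kronecker product are indexed by pairs of coordinates.\<close>

definition kron :: "complex^'n \<Rightarrow> complex^'m \<Rightarrow> complex^('n \<times> 'm)"
  where "kron v w = (\<chi> jk. v $ fst jk * w $ snd jk)"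

definition Z_matrix ::
    "('i \<Rightarrow> complex^3) \<Rightarrow> ('i \<Rightarrow> complex^3) \<Rightarrow> complex^(3 \<times> 3)^'i"
  where "Z_matrix x y = (\<chi> i. kron (x i) (y i))"

text \<open>Dependence is that of the indexed family of rows, so repeated rows count as dependent.\<close>

definition inherited_condition :: "complex^'n^'i \<Rightarrow> bool"
  where "inherited_condition Z \<longleftrightarrow>
    (\<exists>S. S \<subset> UNIV \<and> (\<exists>k. (\<exists>i\<in>S. k i \<noteq> 0) \<and> (\<Sum>i\<in>S. k i *s row i Z) = 0))"

end

theory Submission
  imports Defs
begin

text \<open>
  Five points with no three on a line lie on a nondegenerate conic, which a linear change of
  coordinates turns into the Veronese curve \<open>(s\<^sup>2 : s t : t\<^sup>2)\<close> (\<open>conic_parametrization\<close>). Thus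
  each \<open>x\<^sub>i\<close> has a parameter \<open>w\<^sub>i\<close> on the projective line, and each \<open>y\<^sub>i\<close> has a coordinate \<open>u\<^sub>i\<close>
  on the projective line. The theorem holds because all four of its conditions say the same
  thing: some projective transformation \<open>N\<close> of the projective line takes \<open>w\<^sub>i\<close> to \<open>u\<^sub>i\<close> for all
  \<open>i\<close>. Since three points determine \<open>N\<close>, this is the same as equality of the cross-ratios of the
  \<open>w\<^sub>i\<close> and of the \<open>u\<^sub>i\<close> (\<open>same_cross_ratios_imp_equivalent\<close>).

  Each condition implies equality of cross-ratios. A nontrivial linear dependence of the rows
  \<open>x\<^sub>i \<otimes> y\<^sub>i\<close> has no vanishing coefficient, because no inherited condition holds; contracting it
  with a form that kills three of the five terms leaves a relation between two coefficients, and
  two such relations give the cross-ratios (\<open>kron_dependence_imp_same_cross_ratios\<close>). Under a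
  projection, the bracket of two images is, up to a constant, the determinant of the points with the center, which
  leads to equal cross-ratios (\<open>projection_imp_same_cross_ratios\<close>). Finally, the cross-ratio on
  the conic is that of the parameters (\<open>conic_cross_ratio_conic_pt\<close>), so a map that preserves
  cross-ratios gives the claim at once.

  Conversely, a transformation \<open>N\<close> makes \<open>x\<^sub>i \<otimes> y\<^sub>i\<close> the image, up to a factor, of \<open>veronese
  (w\<^sub>i) \<otimes> w\<^sub>i\<close> under a linear map. These five vectors lie in the four-dimensional space of
  binary cubics, whence the rank drop (\<open>equivalent_imp_kron_dependence\<close>). The projection of the
  conic from the point with parameter \<open>z\<close> is given in parameters by the linear map \<open>veronese w \<mapsto>
  bracket2 w z *s w\<close>; followed by \<open>N\<close> it is the required \<open>T\<close> (\<open>equivalent_imp_projection\<close>), for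
  any center. And \<open>conic_pt w \<mapsto> N w\<close> is an isomorphism of the conic onto the line
  (\<open>isomorphism_from_matrix\<close>).
\<close>

section \<open>Points, brackets and rank\<close>

lemma pt_eq_iff:
  fixes v w :: "complex^'n::finite"
  assumes "v \<noteq> 0" "w \<noteq> 0"
  shows "pt v = pt w \<longleftrightarrow> (\<exists>k. k \<noteq> 0 \<and> w = k *s v)"
proof -
  have r: "proj_rel v v" "proj_rel w w"
    using assms by (auto simp: proj_rel_def intro!: exI[of _ 1])
  then have "pt v = pt w \<longleftrightarrow> proj_rel v w"
    using Quotient3_rel[OF Quotient3_proj, of v w] by simp
  then show ?thesis using assms by (simp add: proj_rel_def)
qed

lemma pt_cases:
  fixes p :: "'n::finite proj"
  obtains v where "v \<noteq> 0" "p = pt v"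
proof
  show "p = pt (rep_pt p)" using Quotient3_abs_rep[OF Quotient3_proj] by metis
  show "rep_pt p \<noteq> 0" using Quotient3_rep_reflp[OF Quotient3_proj] by (auto simp: proj_rel_def)
qed

lemma pt_scale:
  fixes v :: "complex^'n::finite"
  assumes "k \<noteq> 0" "v \<noteq> 0"
  shows "pt (k *s v) = pt v"
proof -
  have "k *s v \<noteq> 0" using assms by simp
  then show ?thesis using pt_eq_iff[of v "k *s v"] assms by auto
qed

lemma bracket2_expand: "bracket2 p q = p $ 1 * q $ 2 - p $ 2 * q $ 1"
  by (simp add: bracket2_def det_2)

lemma vec2_eq_0_iff: "(v :: complex^2) = 0 \<longleftrightarrow> v $ 1 = 0 \<and> v $ 2 = 0"
  by (simp add: vec_eq_iff forall_2)

lemma vec3_eq_0_iff: "(v :: complex^3) = 0 \<longleftrightarrow> v $ 1 = 0 \<and> v $ 2 = 0 \<and> v $ 3 = 0"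
  by (simp add: vec_eq_iff forall_3)

lemma bracket2_eq_0_iff:
  assumes "v \<noteq> 0" "w \<noteq> 0"
  shows "bracket2 v w = 0 \<longleftrightarrow> (\<exists>k. k \<noteq> 0 \<and> w = k *s v)"
proof
  assume 0: "bracket2 v w = 0"
  have "\<exists>k. w = k *s v"
  proof (cases "v $ 1 = 0")
    case True
    then have "v $ 2 \<noteq> 0" using assms by (simp add: vec2_eq_0_iff)
    with True 0 show ?thesis
      by (intro exI[of _ "w $ 2 / v $ 2"]) (auto simp: vec_eq_iff forall_2 bracket2_expand)
  next
    case False
    with 0 show ?thesis
      by (intro exI[of _ "w $ 1 / v $ 1"])
        (auto simp: vec_eq_iff forall_2 bracket2_expand field_simps)
  qed
  then show "\<exists>k. k \<noteq> 0 \<and> w = k *s v" using assms by (metis vector_smult_lzero)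
next
  assume "\<exists>k. k \<noteq> 0 \<and> w = k *s v"
  then show "bracket2 v w = 0" by (auto simp: bracket2_expand)
qed

lemma bracket2_eq_0_iff_pt:
  assumes "v \<noteq> 0" "w \<noteq> 0"
  shows "bracket2 v w = 0 \<longleftrightarrow> pt v = pt w"
  using assms by (simp add: bracket2_eq_0_iff pt_eq_iff)

lemma bracket2_matrix: "bracket2 (M *v v) (M *v w) = det M * bracket2 v w"
  by (simp add: bracket2_expand det_2 matrix_vector_mult_def sum_2 algebra_simps)

lemma bracket3_matrix: "bracket3 (M *v u) (M *v v) (M *v w) = det M * bracket3 u v w"
proof -
  have "(vector [M *v u, M *v v, M *v w] :: complex^3^3) = vector [u, v, w] ** transpose M"
    by (simp add: vec_eq_iff forall_3 matrix_matrix_mult_def matrix_vector_mult_def transpose_def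
        mult.commute)
  then show ?thesis by (simp add: bracket3_def det_mul)
qed

lemma collinear_if_bracket3_eq_0:
  assumes "bracket3 u v w = 0" "u \<noteq> 0" "v \<noteq> 0" "w \<noteq> 0"
  shows "proj_collinear {pt u, pt v, pt w}"
proof -
  let ?M = "vector [u, v, w] :: complex^3^3"
  have "\<not> invertible ?M" using assms(1) by (simp add: invertible_det_nz bracket3_def)
  then obtain a where a: "a \<noteq> 0" "?M *v a = 0"
    by (metis invertible_left_inverse matrix_left_invertible_ker)
  have "(\<Sum>i\<in>UNIV. ?M $ k $ i * a $ i) = 0" for k
    using a(2) by (simp add: vec_eq_iff matrix_vector_mult_def)
  from this[of 1] this[of 2] this[of 3]
  have "(\<Sum>i\<in>UNIV. a $ i * p $ i) = 0" if "p \<in> {u, v, w}" for p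
    using that by (auto simp: mult.commute)
  then show ?thesis
    unfolding proj_collinear_def is_line_def using a(1) assms(2-4) by blast
qed

lemma dot_matrix_vector_mult:
  fixes M :: "'a::comm_semiring_1^'n^'m"
  shows "(\<Sum>i\<in>UNIV. (M *v a) $ i * c $ i) = (\<Sum>j\<in>UNIV. a $ j * (transpose M *v c) $ j)"
proof -
  have "(\<Sum>i\<in>UNIV. (M *v a) $ i * c $ i) = (\<Sum>i\<in>UNIV. \<Sum>j\<in>UNIV. a $ j * (M $ i $ j * c $ i))"
    by (simp add: matrix_vector_mult_def sum_distrib_left sum_distrib_right mult_ac)
  also have "\<dots> = (\<Sum>j\<in>UNIV. \<Sum>i\<in>UNIV. a $ j * (M $ i $ j * c $ i))" by (rule sum.swap)
  finally show ?thesis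
    by (simp add: matrix_vector_mult_def sum_distrib_left transpose_def)
qed

text \<open>The rank is the dimension of the \<^emph>\<open>set\<close> of rows, so equal rows have to be treated apart: they
  make the indexed family dependent, and they make that set too small.\<close>

lemma rank_less_iff_rows_dependent:
  fixes M :: "'a::field^'n^'m"
  shows "rank M < CARD('m) \<longleftrightarrow> (\<exists>k. (\<exists>i. k i \<noteq> 0) \<and> (\<Sum>i\<in>UNIV. k i *s row i M) = 0)"
proof
  assume "\<exists>k. (\<exists>i. k i \<noteq> 0) \<and> (\<Sum>i\<in>UNIV. k i *s row i M) = 0"
  then obtain k i where k: "k i \<noteq> 0" "(\<Sum>i\<in>UNIV. k i *s row i M) = 0" by blast
  let ?W = "(\<lambda>j. row j M) ` (UNIV - {i})"
  have "k i *s row i M = - (\<Sum>j\<in>UNIV - {i}. k j *s row j M)"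
    using k(2) by (simp add: sum.remove[of UNIV i] eq_neg_iff_add_eq_0)
  also have "\<dots> \<in> vec.span ?W"
    by (intro vec.span_neg vec.span_sum vec.span_scale vec.span_base) auto
  finally have "inverse (k i) *s (k i *s row i M) \<in> vec.span ?W" by (rule vec.span_scale)
  then have "row i M \<in> vec.span ?W" using k(1) by (simp add: vector_smult_assoc)
  moreover have "row j M \<in> vec.span ?W" if "j \<noteq> i" for j
    using that by (intro vec.span_base) auto
  ultimately have "row j M \<in> vec.span ?W" for j by (cases "j = i") auto
  then have "rows M \<subseteq> vec.span ?W" unfolding rows_def by auto
  then have "rank M \<le> card ?W"
    unfolding row_rank_def_gen by (intro vec.dim_le_card) auto
  also have "\<dots> \<le> card (UNIV - {i})" by (intro card_image_le) auto
  also have "\<dots> < CARD('m)" by (intro psubset_card_mono) auto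
  finally show "rank M < CARD('m)" .
next
  assume r: "rank M < CARD('m)"
  show "\<exists>k. (\<exists>i. k i \<noteq> 0) \<and> (\<Sum>i\<in>UNIV. k i *s row i M) = 0"
  proof (rule ccontr)
    assume "\<not> ?thesis"
    then have indep: "k i = 0" if "(\<Sum>i\<in>UNIV. k i *s row i M) = 0" for k i using that by blast
    have inj: "inj (\<lambda>i. row i M)"
    proof (rule injI, rule ccontr)
      fix i j assume ij: "row i M = row j M" "i \<noteq> j"
      have "(\<Sum>l\<in>UNIV. (if l = i then 1 else if l = j then - 1 else 0) *s row l M)
          = (\<Sum>l\<in>UNIV. (if l = i then row i M else 0) - (if l = j then row j M else 0))"
        using ij(2) by (intro sum.cong) auto
      also have "\<dots> = 0" using ij(1) by (simp add: sum_subtractf)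
      finally show False
        using indep[of "\<lambda>l. if l = i then 1 else if l = j then - 1 else 0" i] by simp
    qed
    have rows: "rows M = range (\<lambda>i. row i M)" unfolding rows_def by auto
    have "vec.independent (rows M)"
    proof
      assume "vec.dependent (rows M)"
      then obtain c where c: "\<exists>v\<in>rows M. c v \<noteq> 0" "(\<Sum>v\<in>rows M. c v *s v) = 0"
        unfolding rows by (subst (asm) vec.dependent_finite) auto
      have "(\<Sum>i\<in>UNIV. c (row i M) *s row i M) = 0"
        using c(2) unfolding rows by (simp add: sum.reindex[OF inj])
      then show False using indep[of "\<lambda>i. c (row i M)"] c(1) unfolding rows by auto
    qed
    then have "rank M = card (rows M)"
      unfolding row_rank_def_gen by (rule vec.dim_eq_card_independent)
    then show False using r by (simp add: rows card_image[OF inj])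
  qed
qed

lemma rank_le_card_rows:
  fixes M :: "'a::field^'n^'m"
  shows "rank M \<le> CARD('m)"
proof -
  have "rows M = (\<lambda>i. row i M) ` UNIV" unfolding rows_def by auto
  then have "finite (rows M)" "card (rows M) \<le> CARD('m)" by (simp_all add: card_image_le)
  then show ?thesis unfolding row_rank_def_gen using vec.dim_le_card'[of "rows M"] by linarith
qed

lemma linear_dependence_exists:
  fixes f :: "'m::finite \<Rightarrow> 'a::field^'n"
  assumes "CARD('n) < CARD('m)"
  obtains k where "\<exists>i. k i \<noteq> 0" "(\<Sum>i\<in>UNIV. k i *s f i) = 0"
proof -
  have "rank (\<chi> i. f i) \<le> CARD('n)"
    unfolding row_rank_def_gen by (rule dim_subset_UNIV_cart_gen)
  then have "rank (\<chi> i. f i) < CARD('m)" using assms by simp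
  then show thesis using that
    by (auto simp: rank_less_iff_rows_dependent row_def)
qed

lemma full_column_rank_left_inverse:
  fixes B :: "'a::field^'n^'m"
  assumes "rank B = CARD('n)"
  obtains B' where "B' ** B = mat 1"
proof -
  have "vec.span (rows B) = UNIV"
    using vec.dim_eq_full[of "rows B"] assms
    by (simp add: row_rank_def_gen vec.dimension_def card_cart_basis)
  then show thesis using that matrix_left_invertible_span_rows_gen[of B] by blast
qed

lemma fifth_index:
  assumes "CARD('i::finite) = 5" "distinct [a, b, c, d :: 'i]"
  obtains e where "distinct [a, b, c, d, e]" "UNIV = {a, b, c, d, e}"
proof -
  have "card {a, b, c, d} = 4" using assms(2) by simp
  then have "card (UNIV - {a, b, c, d}) = 1"
    using assms(1) by (simp add: card_Diff_subset)
  then obtain e where "UNIV - {a, b, c, d} = {e}" by (auto simp: card_1_singleton_iff)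
  then show thesis using assms(2) by (intro that[of e]) auto
qed

section \<open>Rational parametrization of a conic\<close>

text \<open>The standard parametrization of the conic \<open>v\<^sub>1 v\<^sub>3 = v\<^sub>2\<^sup>2\<close> by the projective line.\<close>

definition veronese :: "complex^2 \<Rightarrow> complex^3"
  where "veronese w = vector [w $ 1 ^ 2, w $ 1 * w $ 2, w $ 2 ^ 2]"

lemma veronese_nth [simp]:
  "veronese w $ 1 = w $ 1 ^ 2" "veronese w $ 2 = w $ 1 * w $ 2" "veronese w $ 3 = w $ 2 ^ 2"
  by (simp_all add: veronese_def)

lemma veronese_eq_0_iff [simp]: "veronese w = 0 \<longleftrightarrow> w = 0"
  by (auto simp: vec3_eq_0_iff vec2_eq_0_iff)

lemma veronese_scale: "veronese (k *s w) = k ^ 2 *s veronese w"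
  by (simp add: vec_eq_iff forall_3 power2_eq_square algebra_simps)

text \<open>A homogeneous Vandermonde determinant. With the third argument fixed, it turns plane
  cross-ratios into cross-ratios of parameters.\<close>

lemma bracket3_veronese:
  "bracket3 (veronese u) (veronese v) (veronese w)
    = bracket2 u v * bracket2 u w * bracket2 v w"
  by (simp add: bracket3_def det_3 bracket2_expand power2_eq_square algebra_simps)

lemma veronese_surj:
  assumes "v $ 1 * v $ 3 = (v $ 2) ^ 2" "v \<noteq> 0"
  obtains k w where "k \<noteq> 0" "w \<noteq> 0" "v = k *s veronese w"
proof (cases "v $ 1 = 0")
  case True
  then have "v $ 2 = 0" "v $ 3 \<noteq> 0" using assms by (auto simp: vec3_eq_0_iff)
  with True show thesis
    by (intro that[of "v $ 3" "vector [0, 1]"]) (auto simp: vec_eq_iff forall_3 forall_2)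
next
  case False
  then show thesis using assms(1)
    by (intro that[of "1 / v $ 1" "vector [v $ 1, v $ 2]"])
      (auto simp: vec_eq_iff forall_3 forall_2 power2_eq_square field_simps)
qed

text \<open>In the basis \<open>p1, p2, p3\<close> the quadratic form has zero diagonal, so its conic is \<open>\<alpha> v\<^sub>2 v\<^sub>3 + \<beta>
  v\<^sub>1 v\<^sub>3 + \<gamma> v\<^sub>1 v\<^sub>2 = 0\<close>. If one coefficient vanished, what remains of the equations of \<open>p4\<close>
  and \<open>p5\<close> would be two independent linear equations for the other two, and the form would be
  zero. Where no coordinate vanishes, the equation is \<open>\<alpha> / v\<^sub>1 + \<beta> / v\<^sub>2 + \<gamma> / v\<^sub>3 = 0\<close>, so one
  may take the three summands proportional to \<open>s\<close>, \<open>t\<close> and \<open>- (s + t)\<close>; clearing denominators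
  gives quadratic forms in \<open>(s, t)\<close>, whose coefficients are the matrix \<open>C\<close> below.\<close>

lemma conic_parametrization:
  assumes C: "is_conic \<omega>"
    and on: "pt p1 \<in> \<omega>" "pt p2 \<in> \<omega>" "pt p3 \<in> \<omega>" "pt p4 \<in> \<omega>" "pt p5 \<in> \<omega>"
    and nz: "bracket3 p1 p2 p3 \<noteq> 0" "bracket3 p4 p2 p3 \<noteq> 0" "bracket3 p1 p4 p3 \<noteq> 0"
      "bracket3 p1 p2 p4 \<noteq> 0" "bracket3 p5 p2 p3 \<noteq> 0" "bracket3 p1 p5 p3 \<noteq> 0"
      "bracket3 p1 p2 p5 \<noteq> 0" "bracket3 p1 p4 p5 \<noteq> 0" "bracket3 p2 p4 p5 \<noteq> 0"
      "bracket3 p3 p4 p5 \<noteq> 0"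
  obtains A A' :: "complex^3^3" where "A ** A' = mat 1" "A' ** A = mat 1"
    "\<omega> = {pt (A *v veronese w) |w. w \<noteq> 0}"
proof -
  obtain Q :: "complex^3^3" where Q: "transpose Q = Q" "Q \<noteq> 0"
    and \<omega>: "\<omega> = {pt v |v. v \<noteq> 0 \<and> (\<Sum>i\<in>UNIV. v $ i * (Q *v v) $ i) = 0}"
    using C unfolding is_conic_def by blast
  define q where "q v = (\<Sum>i\<in>UNIV. v $ i * (Q *v v) $ i)" for v :: "complex^3"
  have \<omega>': "\<omega> = {pt v |v. v \<noteq> 0 \<and> q v = 0}" using \<omega> by (simp add: q_def)
  have q_scale: "q (k *s v) = k ^ 2 * q v" for k v
    by (simp add: q_def sum_3 matrix_vector_mult_def power2_eq_square algebra_simps)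
  have mem: "pt v \<in> \<omega> \<longleftrightarrow> q v = 0" if v: "v \<noteq> 0" for v
  proof
    assume "pt v \<in> \<omega>"
    then obtain v' where "v' \<noteq> 0" "q v' = 0" "pt v = pt v'" unfolding \<omega>' by blast
    then obtain k where "k \<noteq> 0" "v' = k *s v" using pt_eq_iff[OF v, of v'] by auto
    then show "q v = 0" using \<open>q v' = 0\<close> by (simp add: q_scale)
  qed (use v in \<open>auto simp: \<omega>'\<close>)
  define X where "X = transpose (vector [p1, p2, p3] :: complex^3^3)"
  have X: "X *v a = a $ 1 *s p1 + a $ 2 *s p2 + a $ 3 *s p3" for a
    by (simp add: X_def matrix_vector_mult_def transpose_def vec_eq_iff sum_3 algebra_simps)
  have detX: "det X \<noteq> 0" using nz(1) by (simp add: X_def bracket3_def)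
  then obtain X' where X': "X ** X' = mat 1" "X' ** X = mat 1"
    using invertible_det_nz[of X] unfolding invertible_def by blast
  have X'X: "X' *v (X *v a) = a" "X *v (X' *v v) = v" for a v
    by (simp_all add: matrix_vector_mul_assoc X')
  define Q' where "Q' = transpose X ** Q ** X"
  have bil: "(\<Sum>i\<in>UNIV. (X *v a) $ i * (Q *v (X *v b)) $ i) = (\<Sum>i\<in>UNIV. a $ i * (Q' *v b) $ i)" for a b
  proof -
    have "Q' *v b = transpose X *v (Q *v (X *v b))" 
      by (simp add: Q'_def matrix_vector_mul_assoc matrix_mul_assoc)
    then show ?thesis by (simp add: dot_matrix_vector_mult)
  qed
  have symQ': "Q' $ i $ j = Q' $ j $ i" for i j
  proof -
    have "transpose Q' = Q'" by (simp add: Q'_def matrix_transpose_mul Q(1) matrix_mul_assoc)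
    moreover have "transpose Q' $ j $ i = Q' $ i $ j" by (simp add: transpose_def)
    ultimately show ?thesis by simp
  qed
  have p_ne: "p1 \<noteq> 0" "p2 \<noteq> 0" "p3 \<noteq> 0" "p4 \<noteq> 0" "p5 \<noteq> 0"
    using nz by (auto simp: bracket3_def det_3)
  have e: "p1 = X *v vector [1, 0, 0]" "p2 = X *v vector [0, 1, 0]" "p3 = X *v vector [0, 0, 1]"
    by (simp_all add: X)
  have diag: "Q' $ 1 $ 1 = 0" "Q' $ 2 $ 2 = 0" "Q' $ 3 $ 3 = 0"
    using on(1-3) mem p_ne(1-3) e bil[of "vector [1, 0, 0]" "vector [1, 0, 0]"]
      bil[of "vector [0, 1, 0]" "vector [0, 1, 0]"] bil[of "vector [0, 0, 1]" "vector [0, 0, 1]"]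
    by (simp_all add: q_def sum_3 matrix_vector_mult_def[of Q'])
  define \<alpha> where "\<alpha> = Q' $ 2 $ 3"
  define \<beta> where "\<beta> = Q' $ 1 $ 3"
  define \<gamma> where "\<gamma> = Q' $ 1 $ 2"
  have qX: "q (X *v a) = 2 * (\<alpha> * a $ 2 * a $ 3 + \<beta> * a $ 1 * a $ 3 + \<gamma> * a $ 1 * a $ 2)" for a
    unfolding q_def bil
    by (simp add: sum_3 matrix_vector_mult_def diag symQ'[of 2 1] symQ'[of 3 1] symQ'[of 3 2]
        \<alpha>_def \<beta>_def \<gamma>_def algebra_simps)
  define a where "a = X' *v p4"
  define b where "b = X' *v p5"
  have ab: "p4 = X *v a" "p5 = X *v b" by (simp_all add: a_def b_def X'X)
  have a_nz: "a $ 1 \<noteq> 0" "a $ 2 \<noteq> 0" "a $ 3 \<noteq> 0"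
    using nz(2-4) unfolding ab e bracket3_matrix by (auto simp: bracket3_def det_3)
  have b_nz: "b $ 1 \<noteq> 0" "b $ 2 \<noteq> 0" "b $ 3 \<noteq> 0"
    using nz(5-7) unfolding ab e bracket3_matrix by (auto simp: bracket3_def det_3)
  have minors: "a $ 2 * b $ 3 - a $ 3 * b $ 2 \<noteq> 0" "a $ 1 * b $ 3 - a $ 3 * b $ 1 \<noteq> 0"
    "a $ 1 * b $ 2 - a $ 2 * b $ 1 \<noteq> 0"
    using nz(8-10) unfolding ab e bracket3_matrix by (auto simp: bracket3_def det_3)
  have qa: "\<alpha> * a $ 2 * a $ 3 + \<beta> * a $ 1 * a $ 3 + \<gamma> * a $ 1 * a $ 2 = 0"
    and qb: "\<alpha> * b $ 2 * b $ 3 + \<beta> * b $ 1 * b $ 3 + \<gamma> * b $ 1 * b $ 2 = 0"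
    using on(4,5) mem[OF p_ne(4)] mem[OF p_ne(5)]
    unfolding ab qX mult_eq_0_iff[of 2] by (simp_all only: zero_neq_numeral[symmetric] simp_thms)
  have "\<not> (\<alpha> = 0 \<and> \<beta> = 0 \<and> \<gamma> = 0)"
  proof
    assume 0: "\<alpha> = 0 \<and> \<beta> = 0 \<and> \<gamma> = 0"
    have "Q' = 0"
      using 0 diag symQ' by (simp add: vec_eq_iff forall_3 \<alpha>_def \<beta>_def \<gamma>_def)
    have "transpose X' ** Q' ** X' = transpose X' ** transpose X ** Q ** (X ** X')"
      by (simp add: Q'_def matrix_mul_assoc)
    also have "\<dots> = Q" by (simp add: X' matrix_transpose_mul[symmetric])
    finally show False using \<open>Q' = 0\<close> Q(2) by simp
  qed
  moreover have solve: "g = 0 \<and> h = 0"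
    if 1: "g * s + h * t = 0" and 2: "g * s' + h * t' = 0" and 3: "s * t' - t * s' \<noteq> 0"
    for g h s t s' t' :: complex
  proof -
    have "(s * t' - t * s') * g = t' * (g * s + h * t) - t * (g * s' + h * t')"
      "(s * t' - t * s') * h = s * (g * s' + h * t') - s' * (g * s + h * t)"
      by (simp_all add: algebra_simps)
    then show ?thesis using 1 2 3 by simp
  qed
  have "\<beta> = 0 \<and> \<gamma> = 0" if "\<alpha> = 0"
  proof (rule solve)
    have "a $ 1 * (\<beta> * a $ 3 + \<gamma> * a $ 2) = 0"
      using that qa by (simp add: algebra_simps)
    then show "\<beta> * a $ 3 + \<gamma> * a $ 2 = 0" using a_nz by simp
    have "b $ 1 * (\<beta> * b $ 3 + \<gamma> * b $ 2) = 0"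
      using that qb by (simp add: algebra_simps)
    then show "\<beta> * b $ 3 + \<gamma> * b $ 2 = 0" using b_nz by simp
    show "a $ 3 * b $ 2 - a $ 2 * b $ 3 \<noteq> 0" using minors(1) by (simp add: algebra_simps)
  qed
  moreover have "\<alpha> = 0 \<and> \<gamma> = 0" if "\<beta> = 0"
  proof (rule solve)
    have "a $ 2 * (\<alpha> * a $ 3 + \<gamma> * a $ 1) = 0"
      using that qa by (simp add: algebra_simps)
    then show "\<alpha> * a $ 3 + \<gamma> * a $ 1 = 0" using a_nz by simp
    have "b $ 2 * (\<alpha> * b $ 3 + \<gamma> * b $ 1) = 0"
      using that qb by (simp add: algebra_simps)
    then show "\<alpha> * b $ 3 + \<gamma> * b $ 1 = 0" using b_nz by simp
    show "a $ 3 * b $ 1 - a $ 1 * b $ 3 \<noteq> 0" using minors(2) by (simp add: algebra_simps)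
  qed
  moreover have "\<alpha> = 0 \<and> \<beta> = 0" if "\<gamma> = 0"
  proof (rule solve)
    have "a $ 3 * (\<alpha> * a $ 2 + \<beta> * a $ 1) = 0"
      using that qa by (simp add: algebra_simps)
    then show "\<alpha> * a $ 2 + \<beta> * a $ 1 = 0" using a_nz by simp
    have "b $ 3 * (\<alpha> * b $ 2 + \<beta> * b $ 1) = 0"
      using that qb by (simp add: algebra_simps)
    then show "\<alpha> * b $ 2 + \<beta> * b $ 1 = 0" using b_nz by simp
    show "a $ 2 * b $ 1 - a $ 1 * b $ 2 \<noteq> 0" using minors(3) by (simp add: algebra_simps)
  qed
  ultimately have nz': "\<alpha> \<noteq> 0" "\<beta> \<noteq> 0" "\<gamma> \<noteq> 0" by blast+
  \<comment> \<open>Parameters \<open>(s, t)\<close> give \<open>(- \<alpha> t (s + t), - \<beta> s (s + t), \<gamma> s t)\<close>.\<close>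
  define C :: "complex^3^3" where
    "C = vector [vector [0, - \<alpha>, - \<alpha>], vector [- \<beta>, - \<beta>, 0], vector [0, \<gamma>, 0]]"
  define C' :: "complex^3^3" where
    "C' = vector [vector [0, - 1 / \<beta>, - 1 / \<gamma>], vector [0, 0, 1 / \<gamma>], vector [- 1 / \<alpha>, 0, - 1 / \<gamma>]]"
  have CC': "C ** C' = mat 1" "C' ** C = mat 1"
    using nz'
      by (simp_all add: C_def C'_def matrix_matrix_mult_def mat_def vec_eq_iff forall_3 sum_3)
  have qC: "q (X *v (C *v t)) = 2 * \<alpha> * \<beta> * \<gamma> * (t $ 1 * t $ 3 - (t $ 2)^2)" for t
    unfolding qX by (simp add: C_def matrix_vector_mult_def sum_3 power2_eq_square algebra_simps)
  define A where "A = X ** C"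
  define A' where "A' = C' ** X'"
  have AA': "A ** A' = mat 1" "A' ** A = mat 1"
    by (metis (no_types) A_def A'_def CC' X' matrix_mul_assoc matrix_mul_lid)+
  have qA: "q (A *v t) = 2 * \<alpha> * \<beta> * \<gamma> * (t $ 1 * t $ 3 - (t $ 2)^2)" for t
    using qC[of t] by (simp add: A_def matrix_vector_mul_assoc)
  have A_nz: "A *v t \<noteq> 0" if "t \<noteq> 0" for t
    using that AA'(2)
      by (metis matrix_vector_mul_assoc matrix_vector_mul_lid matrix_vector_mult_0_right)
  have "\<omega> = {pt (A *v veronese w) |w. w \<noteq> 0}"
  proof (intro set_eqI iffI)
    fix p assume "p \<in> \<omega>"
    then obtain v where v: "v \<noteq> 0" "q v = 0" "p = pt v" unfolding \<omega>' by blast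
    define t where "t = A' *v v"
    have vt: "v = A *v t" by (simp add: t_def matrix_vector_mul_assoc AA')
    then have "t \<noteq> 0" "t $ 1 * t $ 3 = (t $ 2)^2" using v qA[of t] nz' by auto
    then obtain k w where "k \<noteq> 0" "w \<noteq> 0" "t = k *s veronese w" by (metis veronese_surj)
    then show "p \<in> {pt (A *v veronese w) |w. w \<noteq> 0}"
      using v vt A_nz[of "veronese w"] by (auto simp: vec.scale pt_scale)
  next
    fix p assume "p \<in> {pt (A *v veronese w) |w. w \<noteq> 0}"
    then show "p \<in> \<omega>" using A_nz by (auto simp: mem qA power2_eq_square)
  qed
  with AA' show thesis by (rule that)
qed

section \<open>Linear maps on Kronecker products\<close>

lemma kron_sum_matrix:
  fixes x :: "'i::finite \<Rightarrow> complex^'n::finite" and y :: "'i \<Rightarrow> complex^'m::finite"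
  assumes "(\<Sum>i\<in>UNIV. k i *s kron (x i) (y i)) = 0"
  shows "(\<Sum>i\<in>UNIV. k i *s kron (M *v x i) (N *v y i)) = 0"
proof -
  have 0: "(\<Sum>i\<in>UNIV. k i * (x i $ p * y i $ q)) = 0" for p q
    using assms by (simp add: vec_eq_iff kron_def)
  have "(\<Sum>i\<in>UNIV. k i * ((M *v x i) $ p * (N *v y i) $ q)) = 0" for p q
  proof -
    have "(\<Sum>i\<in>UNIV. k i * ((M *v x i) $ p * (N *v y i) $ q))
        = (\<Sum>i\<in>UNIV. \<Sum>a\<in>UNIV. \<Sum>b\<in>UNIV. M $ p $ a * N $ q $ b * (k i * (x i $ a * y i $ b)))"
      by (simp add: matrix_vector_mult_def sum_product sum_distrib_left mult_ac)
    also have "\<dots> = (\<Sum>a\<in>UNIV. \<Sum>i\<in>UNIV. \<Sum>b\<in>UNIV. M $ p $ a * N $ q $ b * (k i * (x i $ a * y i $ b)))"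
      by (rule sum.swap)
    also have "\<dots> = (\<Sum>a\<in>UNIV. \<Sum>b\<in>UNIV. \<Sum>i\<in>UNIV. M $ p $ a * N $ q $ b * (k i * (x i $ a * y i $ b)))"
      by (intro sum.cong refl sum.swap)
    also have "\<dots> = 0" by (simp add: sum_distrib_left[symmetric] 0)
    finally show ?thesis .
  qed
  then show ?thesis by (simp add: vec_eq_iff kron_def)
qed

lemma kron_scale: "kron (a *s v) (b *s w) = (a * b) *s kron v w"
  by (simp add: kron_def vec_eq_iff)

section \<open>Forms of degree one and two\<close>

lemma is_form_zero: "is_form d (\<lambda>v. 0)"
  unfolding is_form_def by (intro exI[of _ "\<lambda>_. 0"]) simp

lemma is_form_add:
  assumes "is_form d f" "is_form d g"
  shows "is_form d (\<lambda>v. f v + g v)"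
proof -
  obtain a b where "f = (\<lambda>v. \<Sum>\<alpha> | (\<Sum>i\<in>UNIV. \<alpha> i) = d. a \<alpha> * (\<Prod>i\<in>UNIV. v $ i ^ \<alpha> i))"
    "g = (\<lambda>v. \<Sum>\<alpha> | (\<Sum>i\<in>UNIV. \<alpha> i) = d. b \<alpha> * (\<Prod>i\<in>UNIV. v $ i ^ \<alpha> i))"
    using assms unfolding is_form_def by blast
  then show ?thesis
    unfolding is_form_def
    by (intro exI[of _ "\<lambda>\<alpha>. a \<alpha> + b \<alpha>"]) (simp add: sum.distrib distrib_right)
qed

lemma is_form_scale:
  assumes "is_form d f"
  shows "is_form d (\<lambda>v. c * f v)"
proof -
  obtain a where "f = (\<lambda>v. \<Sum>\<alpha> | (\<Sum>i\<in>UNIV. \<alpha> i) = d. a \<alpha> * (\<Prod>i\<in>UNIV. v $ i ^ \<alpha> i))"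
    using assms unfolding is_form_def by blast
  then show ?thesis
    unfolding is_form_def
    by (intro exI[of _ "\<lambda>\<alpha>. c * a \<alpha>"]) (simp add: sum_distrib_left mult.assoc)
qed

lemma is_form_sum:
  assumes "\<And>j. j \<in> S \<Longrightarrow> is_form d (f j)"
  shows "is_form d (\<lambda>v. \<Sum>j\<in>S. f j v)"
  using assms
  by (induction S rule: infinite_finite_induct) (auto intro: is_form_zero is_form_add)

text \<open>Together with closure under sums and scalar multiples, monomials suffice to recognize the
  linear and quadratic maps that occur below as forms.\<close>

lemma is_form_monomial:
  assumes "(\<Sum>i\<in>UNIV. \<beta> i) = d"
  shows "is_form d (\<lambda>v. \<Prod>i\<in>UNIV. v $ i ^ \<beta> i)"
  unfolding is_form_def
proof (intro exI allI)
  fix v :: "complex^'a"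
  have "(\<Sum>\<alpha> | (\<Sum>i\<in>UNIV. \<alpha> i) = d. (if \<alpha> = \<beta> then 1 else 0) * (\<Prod>i\<in>UNIV. v $ i ^ \<alpha> i))
      = (\<Sum>\<alpha> | (\<Sum>i\<in>UNIV. \<alpha> i) = d. if \<alpha> = \<beta> then \<Prod>i\<in>UNIV. v $ i ^ \<alpha> i else 0)"
    by (intro sum.cong) auto
  then show "(\<Prod>i\<in>UNIV. v $ i ^ \<beta> i) =
      (\<Sum>\<alpha> | (\<Sum>i\<in>UNIV. \<alpha> i) = d. (if \<alpha> = \<beta> then 1 else 0) * (\<Prod>i\<in>UNIV. v $ i ^ \<alpha> i))"
    using assms by (simp add: sum.delta finite_exponents)
qed

lemma prod_unit_exponent: "(\<Prod>l\<in>UNIV. (v :: complex^'n::finite) $ l ^ (if l = i then 1 else 0)) = v $ i"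
proof -
  have "(\<Prod>l\<in>UNIV. v $ l ^ (if l = i then 1 else 0)) = (\<Prod>l\<in>UNIV. if l = i then v $ l else 1)"
    by (intro prod.cong) auto
  then show ?thesis by simp
qed

lemma is_form_coordinate: "is_form 1 (\<lambda>v. v $ i)"
  using is_form_monomial[of "\<lambda>l. if l = i then 1 else 0" 1] unfolding prod_unit_exponent by simp

lemma is_form_coordinate_product: "is_form 2 (\<lambda>v. v $ i * v $ j)"
  using is_form_monomial[of "\<lambda>l. (if l = i then 1 else 0) + (if l = j then 1 else 0)" 2]
  unfolding power_add prod.distrib prod_unit_exponent by (simp add: sum.distrib)

lemma is_form_linear: "is_form 1 (\<lambda>v. (M *v v) $ j)"
  unfolding matrix_vector_mult_def
  using is_form_coordinate by (auto intro!: is_form_sum is_form_scale)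

lemma is_form_linear_product: "is_form 2 (\<lambda>v. (M *v v) $ i * (M *v v) $ j)"
proof -
  have "(\<lambda>v. (M *v v) $ i * (M *v v) $ j)
      = (\<lambda>v. \<Sum>a\<in>UNIV. \<Sum>b\<in>UNIV. (M $ i $ a * M $ j $ b) * (v $ a * v $ b))"
    by (simp add: matrix_vector_mult_def sum_product mult_ac)
  moreover have "is_form 2 \<dots>"
    by (intro is_form_sum is_form_scale is_form_coordinate_product)
  ultimately show ?thesis by simp
qed

lemma is_form_veronese: "is_form 2 (\<lambda>v. (A *v veronese (M *v v)) $ j)"
proof -
  have "(\<lambda>v. (A *v veronese (M *v v)) $ j)
      = (\<lambda>v. A $ j $ 1 * ((M *v v) $ 1 * (M *v v) $ 1) + A $ j $ 2 * ((M *v v) $ 1 * (M *v v) $ 2)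
          + A $ j $ 3 * ((M *v v) $ 2 * (M *v v) $ 2))"
    by (simp add: matrix_vector_mult_def[of A] sum_3 power2_eq_square)
  moreover have "is_form 2 \<dots>"
    by (intro is_form_add is_form_scale is_form_linear_product)
  ultimately show ?thesis by simp
qed

section \<open>Cross-ratios in coordinates\<close>

lemma proj_rel_refl: "v \<noteq> 0 \<Longrightarrow> proj_rel v v"
  by (auto simp: proj_rel_def intro!: exI[of _ 1])

lemma cross_ratio_pt:
  assumes "v1 \<noteq> 0" "v2 \<noteq> 0" "v3 \<noteq> 0" "v4 \<noteq> 0"
  shows "cross_ratio (pt v1) (pt v2) (pt v3) (pt v4)
    = (bracket2 v1 v3 * bracket2 v2 v4) / (bracket2 v1 v4 * bracket2 v2 v3)"
  using assms by (intro cross_ratio.abs_eq proj_rel_refl)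

lemma plane_cross_ratio_pt:
  assumes "v1 \<noteq> 0" "v2 \<noteq> 0" "v3 \<noteq> 0" "v4 \<noteq> 0" "v5 \<noteq> 0"
  shows "plane_cross_ratio (pt v1) (pt v2) (pt v3) (pt v4) (pt v5)
    = (bracket3 v1 v3 v5 * bracket3 v2 v4 v5) / (bracket3 v1 v4 v5 * bracket3 v2 v3 v5)"
  using assms by (intro plane_cross_ratio.abs_eq proj_rel_refl)

section \<open>A conic and a line with fixed parametrizations\<close>

text \<open>All later arguments take place in the coordinates \<open>w\<close> of the conic and \<open>u\<close> of the line. The
  matrix \<open>B\<close> parametrizes the line and \<open>B'\<close> recovers the coordinate of a vector on it.\<close>

locale parametrized_conic_and_line =
  fixes A A' :: "complex^3^3" and B :: "complex^2^3" and B' :: "complex^3^2"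
    and \<omega> L :: "3 proj set" and \<iota> :: "2 proj \<Rightarrow> 3 proj"
  assumes A_inverse: "A ** A' = mat 1" "A' ** A = mat 1" and B_inverse: "B' ** B = mat 1"
    and conic: "\<omega> = {pt (A *v veronese w) |w. w \<noteq> 0}"
    and ident: "\<And>u. u \<noteq> 0 \<Longrightarrow> \<iota> (pt u) = pt (B *v u)"
    and range_ident: "range \<iota> = L"
begin

lemma A_cancel [simp]: "A' *v (A *v v) = v" "A *v (A' *v v) = v"
  by (simp_all add: matrix_vector_mul_assoc A_inverse)

lemma B_cancel [simp]: "B' *v (B *v v) = v"
  by (simp add: matrix_vector_mul_assoc B_inverse)

lemma A_eq_0_iff [simp]: "A *v v = 0 \<longleftrightarrow> v = 0"
  by (metis A_cancel(1) matrix_vector_mult_0_right)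

lemma B_eq_0_iff [simp]: "B *v v = 0 \<longleftrightarrow> v = 0"
  by (metis B_cancel matrix_vector_mult_0_right)

lemma det_A: "det A \<noteq> 0"
  using A_inverse invertible_det_nz[of A] unfolding invertible_def by blast

definition conic_pt :: "complex^2 \<Rightarrow> 3 proj"
  where "conic_pt w = pt (A *v veronese w)"

lemma conic_cases:
  assumes "p \<in> \<omega>"
  obtains w where "w \<noteq> 0" "p = conic_pt w"
  using assms unfolding conic conic_pt_def by blast

lemma conic_pt_in: "w \<noteq> 0 \<Longrightarrow> conic_pt w \<in> \<omega>"
  unfolding conic conic_pt_def by blast

lemma conic_pt_scale: "k \<noteq> 0 \<Longrightarrow> w \<noteq> 0 \<Longrightarrow> conic_pt (k *s w) = conic_pt w"
  by (simp add: conic_pt_def veronese_scale vec.scale pt_scale)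

lemma conic_pt_eq_iff:
  assumes "w \<noteq> 0" "w' \<noteq> 0"
  shows "conic_pt w = conic_pt w' \<longleftrightarrow> pt w = pt w'"
proof
  assume "conic_pt w = conic_pt w'"
  then obtain k where "A *v veronese w' = k *s (A *v veronese w)"
    using assms pt_eq_iff[of "A *v veronese w" "A *v veronese w'"] by (auto simp: conic_pt_def)
  then have "A *v veronese w' = A *v (k *s veronese w)" by (simp add: vec.scale)
  then have "veronese w' = k *s veronese w" by (metis A_cancel(1))
  then have eqs: "w' $ 1 ^ 2 = k * w $ 1 ^ 2" "w' $ 1 * w' $ 2 = k * (w $ 1 * w $ 2)"
    "w' $ 2 ^ 2 = k * w $ 2 ^ 2"
    by (simp_all add: vec_eq_iff forall_3)
  have "bracket2 w w' ^ 2
      = w $ 1 ^ 2 * w' $ 2 ^ 2 - 2 * (w $ 1 * w $ 2) * (w' $ 1 * w' $ 2) + w $ 2 ^ 2 * w' $ 1 ^ 2"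
    by (simp add: bracket2_expand power2_eq_square algebra_simps)
  also have "\<dots> = 0" unfolding eqs by (simp add: power2_eq_square algebra_simps)
  finally show "pt w = pt w'" using assms bracket2_eq_0_iff_pt by auto
next
  assume "pt w = pt w'"
  then obtain k where "k \<noteq> 0" "w' = k *s w" using assms pt_eq_iff by blast
  then show "conic_pt w = conic_pt w'" using assms conic_pt_scale by simp
qed

lemma ident_eq_iff:
  assumes "u \<noteq> 0" "u' \<noteq> 0"
  shows "\<iota> (pt u) = \<iota> (pt u') \<longleftrightarrow> pt u = pt u'"
proof
  assume "\<iota> (pt u) = \<iota> (pt u')"
  then obtain k where k: "k \<noteq> 0" "B *v u' = k *s (B *v u)"
    using assms ident pt_eq_iff[of "B *v u" "B *v u'"] by auto
  then have "B *v u' = B *v (k *s u)" by (simp add: vec.scale)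
  then have "u' = k *s u" by (metis B_cancel)
  then show "pt u = pt u'" using k assms by (simp add: pt_scale)
qed simp

lemma inj_ident: "inj \<iota>"
proof (rule injI)
  fix p q :: "2 proj" assume eq: "\<iota> p = \<iota> q"
  obtain u u' where "u \<noteq> 0" "p = pt u" "u' \<noteq> 0" "q = pt u'" by (metis pt_cases)
  then show "p = q" using eq ident_eq_iff by simp
qed

lemma line_cases:
  assumes "p \<in> L"
  obtains u where "u \<noteq> 0" "p = \<iota> (pt u)"
  using assms range_ident by (metis pt_cases rangeE)

lemma infinite_conic: "infinite \<omega>"
proof -
  have "inj (\<lambda>n::nat. conic_pt (vector [1, of_nat n]))"
  proof (rule injI)
    fix m n :: nat
    assume eq: "conic_pt (vector [1, of_nat m]) = conic_pt (vector [1, of_nat n])"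
    have ne: "(vector [1, of_nat m] :: complex^2) \<noteq> 0" for m by (simp add: vec2_eq_0_iff)
    have "bracket2 (vector [1, of_nat m]) (vector [1, of_nat n]) = 0"
      using eq conic_pt_eq_iff[OF ne ne] bracket2_eq_0_iff_pt[OF ne ne] by simp
    then show "m = n" by (simp add: bracket2_expand)
  qed
  moreover have "range (\<lambda>n::nat. conic_pt (vector [1, of_nat n])) \<subseteq> \<omega>"
    by (auto intro!: conic_pt_in simp: vec2_eq_0_iff)
  ultimately show ?thesis by (meson finite_subset range_inj_infinite)
qed

lemma bracket3_conic:
  "bracket3 (A *v veronese u) (A *v veronese v) (A *v veronese w)
    = det A * (bracket2 u v * bracket2 u w * bracket2 v w)"
  by (simp add: bracket3_matrix bracket3_veronese)

text \<open>In the plane cross-ratio taken from \<open>conic_pt w\<close>, the factors \<open>det A\<close> and all brackets that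
  involve \<open>w\<close> cancel. This is why its value does not depend on the further point, and why the
  definite description picks out the cross-ratio of the parameters. The conic is infinite, so
  further points exist and the value is unique.\<close>

lemma conic_cross_ratio_conic_pt:
  assumes "w1 \<noteq> 0" "w2 \<noteq> 0" "w3 \<noteq> 0" "w4 \<noteq> 0"
    and "bracket2 w1 w4 \<noteq> 0" "bracket2 w2 w3 \<noteq> 0"
  shows "conic_cross_ratio \<omega> (conic_pt w1) (conic_pt w2) (conic_pt w3) (conic_pt w4)
    = (bracket2 w1 w3 * bracket2 w2 w4) / (bracket2 w1 w4 * bracket2 w2 w3)"
    (is "_ = ?r")
proof -
  let ?S = "\<omega> - {conic_pt w1, conic_pt w2, conic_pt w3, conic_pt w4}"
  have *: "plane_cross_ratio (conic_pt w1) (conic_pt w2) (conic_pt w3) (conic_pt w4) p = ?r"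
    if p: "p \<in> ?S" for p
  proof -
    obtain w where w: "w \<noteq> 0" "p = conic_pt w" using p conic_cases[of p] by auto
    have nz: "bracket2 w1 w \<noteq> 0" "bracket2 w2 w \<noteq> 0" "bracket2 w3 w \<noteq> 0" "bracket2 w4 w \<noteq> 0"
      using p w assms by (auto simp: bracket2_eq_0_iff_pt conic_pt_eq_iff)
    show ?thesis
      using assms w nz det_A
      by (simp add: conic_pt_def plane_cross_ratio_pt bracket3_conic divide_simps)
  qed
  have "?S \<noteq> {}"
    using infinite_conic by (metis Diff_eq_empty_iff finite.emptyI finite.insertI finite_subset)
  then show ?thesis
    unfolding conic_cross_ratio_def by (intro the_equality) (use * in auto)
qed

end

section \<open>The isomorphism induced by a matrix\<close>

context parametrized_conic_and_line
begin

text \<open>The map sends the point with parameter \<open>w\<close> to the point with coordinate \<open>N w\<close>. For the point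
  of the conic with \<open>veronese w = (s\<^sup>2, s t, t\<^sup>2)\<close> the parameter is \<open>(s\<^sup>2 : s t)\<close> or \<open>(s t :
  t\<^sup>2)\<close>, so two linear charts show that the map is a morphism; the inverse is given by quadratic
  forms on the whole line. Cross-ratios are preserved because all four brackets acquire the same
  factor \<open>det N\<close>.\<close>

lemma isomorphism_from_matrix:
  assumes N: "N ** N' = mat 1" "N' ** N = mat 1"
  obtains F where "proj_isomorphism \<omega> L F" "cross_ratio_preserving \<omega> \<iota> F"
    "\<And>w. w \<noteq> 0 \<Longrightarrow> F (conic_pt w) = \<iota> (pt (N *v w))"
proof -
  have N_cancel [simp]: "N' *v (N *v v) = v" "N *v (N' *v v) = v" for v
    by (simp_all add: matrix_vector_mul_assoc N)
  have N_0 [simp]: "N *v v = 0 \<longleftrightarrow> v = 0" "N' *v v = 0 \<longleftrightarrow> v = 0" for v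
    by (metis N_cancel matrix_vector_mult_0_right)+
  have pt_N: "pt (N *v w) = pt (N *v w')" if ww: "pt w = pt w'" "w \<noteq> 0" "w' \<noteq> 0" for w w'
  proof -
    obtain k where "k \<noteq> 0" "w' = k *s w" using ww pt_eq_iff[of w w'] by auto
    then show ?thesis using ww by (simp add: vec.scale pt_scale)
  qed
  define F where "F p = \<iota> (pt (N *v (SOME w. w \<noteq> 0 \<and> p = conic_pt w)))" for p
  have F: "F (conic_pt w) = \<iota> (pt (N *v w))" if w: "w \<noteq> 0" for w
  proof -
    define w' where "w' = (SOME w'. w' \<noteq> 0 \<and> conic_pt w = conic_pt w')"
    have "w' \<noteq> 0 \<and> conic_pt w = conic_pt w'"
      unfolding w'_def by (rule someI[of _ w]) (use w in auto)
    then show ?thesis using w pt_N conic_pt_eq_iff unfolding F_def w'_def[symmetric] by metis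
  qed
  have F_B: "F (conic_pt w) = pt (B *v (N *v w))" if "w \<noteq> 0" for w
    using that by (simp add: F ident)
  have bij: "bij_betw F \<omega> L"
  proof (rule bij_betw_imageI)
    show "inj_on F \<omega>"
    proof (rule inj_onI)
      fix p q assume pq: "p \<in> \<omega>" "q \<in> \<omega>" "F p = F q"
      obtain w where w: "w \<noteq> 0" "p = conic_pt w" using pq(1) by (rule conic_cases)
      obtain w' where w': "w' \<noteq> 0" "q = conic_pt w'" using pq(2) by (rule conic_cases)
      have "pt (N *v w) = pt (N *v w')" using pq(3) w w' by (simp add: F ident_eq_iff)
      then obtain k where k: "k \<noteq> 0" "N *v w' = k *s (N *v w)"
        using pt_eq_iff[of "N *v w" "N *v w'"] w w' by auto
      then have "N *v w' = N *v (k *s w)" by (simp add: vec.scale)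
      then have "w' = k *s w" by (metis N_cancel(1))
      then show "p = q" using w w' k conic_pt_scale by simp
    qed
    show "F ` \<omega> = L"
    proof
      show "F ` \<omega> \<subseteq> L" using range_ident by (auto elim!: conic_cases simp: F)
      show "L \<subseteq> F ` \<omega>"
      proof
        fix p assume "p \<in> L"
        then obtain u where u: "u \<noteq> 0" "p = \<iota> (pt u)" by (rule line_cases)
        then have "p = F (conic_pt (N' *v u))" by (simp add: F)
        then show "p \<in> F ` \<omega>" using u conic_pt_in by auto
      qed
    qed
  qed
  have inv_F: "inv_into \<omega> F (\<iota> (pt u)) = conic_pt (N' *v u)" if "u \<noteq> 0" for u
  proof -
    have "F (conic_pt (N' *v u)) = \<iota> (pt u)" using that by (simp add: F)
    then show ?thesis using bij that conic_pt_in by (metis N_0(2) bij_betw_inv_into_left)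
  qed
  \<comment> \<open>Applied to \<open>l = 1\<close> and \<open>l = 2\<close>, where \<open>P\<close> extracts \<open>(s\<^sup>2, s t)\<close> and \<open>(s t, t\<^sup>2)\<close>, multiples
    of the parameter \<open>(s, t)\<close>.\<close>
  have chart: "\<exists>d (f :: complex^3 \<Rightarrow> complex^3). (\<forall>j. is_form d (\<lambda>v. f v $ j)) \<and>
       (\<exists>v. v \<noteq> 0 \<and> conic_pt w = pt v \<and> f v \<noteq> 0) \<and>
       (\<forall>v. v \<noteq> 0 \<and> pt v \<in> \<omega> \<and> f v \<noteq> 0 \<longrightarrow> F (pt v) = pt (f v))"
    if w: "w \<noteq> 0" "w $ l \<noteq> 0" and P: "\<And>w. P *v veronese w = w $ l *s w" for w l and P :: "complex^3^2"
  proof (intro exI conjI allI impI)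
    define f where "f v = B ** N ** P ** A' *v v" for v
    have fA: "f (A *v veronese w) = w $ l *s (B *v (N *v w))" for w
    proof -
      have "f (A *v veronese w) = B *v (N *v (P *v (A' *v (A *v veronese w))))"
        by (simp only: f_def matrix_vector_mul_assoc[symmetric])
      then show ?thesis by (simp add: P vec.scale)
    qed
    show "is_form 1 (\<lambda>v. f v $ j)" for j unfolding f_def by (rule is_form_linear)
    show "A *v veronese w \<noteq> 0" "conic_pt w = pt (A *v veronese w)" "f (A *v veronese w) \<noteq> 0"
      using w by (simp_all add: conic_pt_def fA)
    fix v assume v: "v \<noteq> 0 \<and> pt v \<in> \<omega> \<and> f v \<noteq> 0"
    then obtain w' where w': "w' \<noteq> 0" "pt v = conic_pt w'" by (blast elim: conic_cases)
    then obtain k where k: "k \<noteq> 0" "v = k *s (A *v veronese w')"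
      using v pt_eq_iff[of "A *v veronese w'" v] by (auto simp: conic_pt_def)
    have fv: "f v = (k * w' $ l) *s (B *v (N *v w'))"
    proof -
      have "f v = k *s f (A *v veronese w')" by (simp add: f_def k vec.scale)
      then show ?thesis by (simp add: fA)
    qed
    then have "k * w' $ l \<noteq> 0" using v by auto
    then have "pt (f v) = pt (B *v (N *v w'))" unfolding fv using w' by (intro pt_scale) auto
    then show "F (pt v) = pt (f v)" using w' by (simp add: F_B)
  qed
  have mor: "proj_morphism \<omega> F"
    unfolding proj_morphism_def
  proof
    fix p assume "p \<in> \<omega>"
    then obtain w where w: "w \<noteq> 0" "p = conic_pt w" by (rule conic_cases)
    define P1 :: "complex^3^2" where "P1 = vector [vector [1, 0, 0], vector [0, 1, 0]]"
    define P2 :: "complex^3^2" where "P2 = vector [vector [0, 1, 0], vector [0, 0, 1]]"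
    have P1: "P1 *v veronese w = w $ 1 *s w" and P2: "P2 *v veronese w = w $ 2 *s w" for w
      by (simp_all add: P1_def P2_def matrix_vector_mult_def vec_eq_iff forall_2 sum_3 power2_eq_square)
    from w consider "w $ 1 \<noteq> 0" | "w $ 2 \<noteq> 0" by (auto simp: vec2_eq_0_iff)
    then show "\<exists>d (f :: complex^3 \<Rightarrow> complex^3). (\<forall>j. is_form d (\<lambda>v. f v $ j)) \<and>
       (\<exists>v. v \<noteq> 0 \<and> p = pt v \<and> f v \<noteq> 0) \<and>
       (\<forall>v. v \<noteq> 0 \<and> pt v \<in> \<omega> \<and> f v \<noteq> 0 \<longrightarrow> F (pt v) = pt (f v))"
    proof cases
      case 1
      then show ?thesis unfolding w(2) by (rule chart[OF w(1) _ P1])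
    next
      case 2
      then show ?thesis unfolding w(2) by (rule chart[OF w(1) _ P2])
    qed
  qed
  have inv_mor: "proj_morphism L (inv_into \<omega> F)"
    unfolding proj_morphism_def
  proof
    fix p assume "p \<in> L"
    then obtain u where u: "u \<noteq> 0" "p = \<iota> (pt u)" by (rule line_cases)
    define f where "f v = A *v veronese ((N' ** B') *v v)" for v
    have fB: "f (k *s (B *v u)) = k ^ 2 *s (A *v veronese (N' *v u))" for k u
      by (simp add: f_def matrix_vector_mul_assoc[symmetric] vec.scale veronese_scale)
    show "\<exists>d (f :: complex^3 \<Rightarrow> complex^3). (\<forall>j. is_form d (\<lambda>v. f v $ j)) \<and>
       (\<exists>v. v \<noteq> 0 \<and> p = pt v \<and> f v \<noteq> 0) \<and>
       (\<forall>v. v \<noteq> 0 \<and> pt v \<in> L \<and> f v \<noteq> 0 \<longrightarrow> inv_into \<omega> F (pt v) = pt (f v))"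
    proof (intro exI conjI allI impI)
      show "is_form 2 (\<lambda>v. f v $ j)" for j unfolding f_def by (rule is_form_veronese)
      show "B *v u \<noteq> 0" "p = pt (B *v u)" "f (B *v u) \<noteq> 0"
        using u fB[of 1 u] by (simp_all add: ident)
      fix v assume v: "v \<noteq> 0 \<and> pt v \<in> L \<and> f v \<noteq> 0"
      then obtain u' where u': "u' \<noteq> 0" "pt v = \<iota> (pt u')" by (blast elim: line_cases)
      then obtain k where k: "k \<noteq> 0" "v = k *s (B *v u')"
        using v pt_eq_iff[of "B *v u'" v] by (auto simp: ident)
      have "pt (f v) = conic_pt (N' *v u')"
        using u' k(1) unfolding k(2) fB conic_pt_def by (intro pt_scale) auto
      then show "inv_into \<omega> F (pt v) = pt (f v)" using u' inv_F by simp
    qed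
  qed
  have cr: "cross_ratio_preserving \<omega> \<iota> F"
    unfolding cross_ratio_preserving_def
  proof (intro ballI impI)
    fix p1 p2 p3 p4
    assume p: "p1 \<in> \<omega>" "p2 \<in> \<omega>" "p3 \<in> \<omega>" "p4 \<in> \<omega>" and d: "distinct [p1, p2, p3, p4]"
    obtain w1 where w1: "w1 \<noteq> 0" "p1 = conic_pt w1" using p(1) by (rule conic_cases)
    obtain w2 where w2: "w2 \<noteq> 0" "p2 = conic_pt w2" using p(2) by (rule conic_cases)
    obtain w3 where w3: "w3 \<noteq> 0" "p3 = conic_pt w3" using p(3) by (rule conic_cases)
    obtain w4 where w4: "w4 \<noteq> 0" "p4 = conic_pt w4" using p(4) by (rule conic_cases)
    have nz: "bracket2 w1 w4 \<noteq> 0" "bracket2 w2 w3 \<noteq> 0"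
      using d w1 w2 w3 w4 by (auto simp: bracket2_eq_0_iff_pt conic_pt_eq_iff)
    have "det N \<noteq> 0" using N invertible_det_nz[of N] unfolding invertible_def by blast
    then show "conic_cross_ratio \<omega> p1 p2 p3 p4 =
       cross_ratio (inv \<iota> (F p1)) (inv \<iota> (F p2)) (inv \<iota> (F p3)) (inv \<iota> (F p4))"
      using nz w1 w2 w3 w4
      by (simp add: conic_cross_ratio_conic_pt F inv_f_f[OF inj_ident] cross_ratio_pt bracket2_matrix)
  qed
  show thesis using bij mor inv_mor cr F by (intro that[of F]) (auto simp: proj_isomorphism_def)
qed

end

section \<open>Five points on the conic and five on the line\<close>

locale conic_line_configuration = parametrized_conic_and_line +
  fixes x y :: "'i::finite \<Rightarrow> complex^3" and w u :: "'i \<Rightarrow> complex^2"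
    and \<alpha> \<beta> :: "'i \<Rightarrow> complex"
  assumes x_eq: "\<And>i. x i = \<alpha> i *s (A *v veronese (w i))"
    and y_eq: "\<And>i. y i = \<beta> i *s (B *v u i)"
    and scalar_nz: "\<And>i. \<alpha> i \<noteq> 0" "\<And>i. \<beta> i \<noteq> 0"
    and param_nz: "\<And>i. w i \<noteq> 0" "\<And>i. u i \<noteq> 0"
    and w_distinct: "\<And>i j. i \<noteq> j \<Longrightarrow> bracket2 (w i) (w j) \<noteq> 0"
    and u_distinct: "\<And>i j. i \<noteq> j \<Longrightarrow> bracket2 (u i) (u j) \<noteq> 0"
    and five: "CARD('i) = 5"
begin

lemma pt_x: "pt (x i) = conic_pt (w i)"
  using scalar_nz param_nz by (simp add: x_eq conic_pt_def pt_scale)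

lemma pt_y: "pt (y i) = \<iota> (pt (u i))"
  using scalar_nz param_nz by (simp add: y_eq ident pt_scale)

text \<open>Equality of the cross-ratios of parameters and coordinates, with denominators cleared.\<close>

definition same_cross_ratios :: bool
  where "same_cross_ratios \<longleftrightarrow> (\<forall>a b c d. distinct [a, b, c, d] \<longrightarrow>
    bracket2 (w a) (w c) * bracket2 (w b) (w d) * (bracket2 (u a) (u d) * bracket2 (u b) (u c))
    = bracket2 (u a) (u c) * bracket2 (u b) (u d) * (bracket2 (w a) (w d) * bracket2 (w b) (w c)))"

definition parameters_equivalent :: bool
  where "parameters_equivalent \<longleftrightarrow>
    (\<exists>N N' :: complex^2^2. N ** N' = mat 1 \<and> N' ** N = mat 1 \<and> (\<forall>i. pt (N *v w i) = pt (u i)))"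

text \<open>There is a unique projective map of the line with three prescribed values. The matrix \<open>N\<close>
  below is that map for the indices \<open>a, b, c\<close>, written with brackets: it sends \<open>w a\<close> and \<open>w b\<close>
  to multiples of \<open>u a\<close> and \<open>u b\<close>, and its two coefficients are chosen such that \<open>w c\<close> goes to a
  multiple of \<open>u c\<close>. For a further index, \<open>N w\<close> is proportional to \<open>u\<close> exactly if the
  cross-ratios with the first three agree.\<close>

lemma same_cross_ratios_imp_equivalent:
  assumes same_cross_ratios
  shows parameters_equivalent
proof -
  have "\<exists>l :: 'i list. length l = 3 \<and> distinct l"
  proof -
    obtain S :: "'i set" where "card S = 3"
      using ex_card[of 3 "UNIV :: 'i set"] five by auto
    then show ?thesis by (metis card.infinite distinct_card finite_distinct_list zero_neq_numeral)
  qed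
  then obtain a b c :: 'i where d: "distinct [a, b, c]"
    by (metis length_0_conv length_Suc_conv numeral_3_eq_3)
  define N :: "complex^2^2" where
    "N = (\<chi> p q. 
        bracket2 (w c) (w a) * bracket2 (u b) (u c) * u a $ p * (if q = 1 then w b $ 2 else - w b $ 1)
      - bracket2 (w c) (w b) * bracket2 (u a) (u c) * u b $ p * (if q = 1 then w a $ 2 else - w a $ 1))"
  have N: "N *v v = (bracket2 (w c) (w a) * bracket2 (u b) (u c) * bracket2 v (w b)) *s u a
      - (bracket2 (w c) (w b) * bracket2 (u a) (u c) * bracket2 v (w a)) *s u b" for v
    by (simp add: N_def matrix_vector_mult_def vec_eq_iff forall_2 sum_2 bracket2_expand algebra_simps)
  have nz: "bracket2 (w c) (w a) \<noteq> 0" "bracket2 (u b) (u c) \<noteq> 0" "bracket2 (w c) (w b) \<noteq> 0"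
    "bracket2 (u a) (u c) \<noteq> 0" "bracket2 (u a) (u b) \<noteq> 0" "bracket2 (w a) (w b) \<noteq> 0"
    using d w_distinct u_distinct by auto
  have inj: "N *v v \<noteq> 0" if v: "v \<noteq> 0" for v
  proof
    assume 0: "N *v v = 0"
    have skew: "bracket2 p p = 0" "bracket2 q p = - bracket2 p q" for p q
      by (simp_all add: bracket2_expand)
    have lin: "bracket2 (k *s p - l *s q) r = k * bracket2 p r - l * bracket2 q r" for k l p q r
      by (simp add: bracket2_expand algebra_simps)
    have "bracket2 (N *v v) (u b) = 0" "bracket2 (N *v v) (u a) = 0"
      unfolding 0 by (simp_all add: bracket2_expand)
    then have "bracket2 v (w b) = 0" "bracket2 v (w a) = 0"
      unfolding N lin using nz by (simp_all add: skew(1) skew(2)[of "u b" "u a"])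
    then have "pt (w a) = pt (w b)" using v param_nz by (simp add: bracket2_eq_0_iff_pt)
    then show False using nz(6) param_nz by (simp add: bracket2_eq_0_iff_pt)
  qed
  then have "\<exists>N'. N' ** N = mat 1" using matrix_left_invertible_ker by blast
  then obtain N' where N': "N' ** N = mat 1" ..
  then have "N ** N' = mat 1" by (simp add: matrix_left_right_inverse)
  moreover have "pt (N *v w i) = pt (u i)" for i
  proof -
    have "bracket2 (N *v w i) (u i)
        = bracket2 (w c) (w a) * bracket2 (u b) (u c) * (bracket2 (w i) (w b) * bracket2 (u a) (u i))
        - bracket2 (w c) (w b) * bracket2 (u a) (u c) * (bracket2 (w i) (w a) * bracket2 (u b) (u i))"
      unfolding N by (simp add: bracket2_expand algebra_simps)
    also have "\<dots> = 0"
    proof (cases "i \<in> {a, b, c}")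
      case True
      then show ?thesis by (elim insertE emptyE) (simp_all add: bracket2_expand algebra_simps)
    next
      case False
      \<comment> \<open>The coefficients of \<open>N\<close> pair the fixed indices as \<open>c, a\<close> and \<open>c, b\<close>, which dictates this
        order.\<close>
      then have "distinct [c, i, a, b]" using d by auto
      then have "bracket2 (w c) (w a) * bracket2 (w i) (w b) * (bracket2 (u c) (u b) * bracket2 (u i) (u a))
        = bracket2 (u c) (u a) * bracket2 (u i) (u b) * (bracket2 (w c) (w b) * bracket2 (w i) (w a))"
        using assms unfolding same_cross_ratios_def by blast
      moreover have skew: "bracket2 (u c) (u b) = - bracket2 (u b) (u c)" "bracket2 (u i) (u a) = - bracket2 (u a) (u i)"
         "bracket2 (u c) (u a) = - bracket2 (u a) (u c)" "bracket2 (u i) (u b) = - bracket2 (u b) (u i)"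
        by (simp_all add: bracket2_expand)
      ultimately show ?thesis by (simp add: algebra_simps)
    qed
    finally show ?thesis using inj param_nz by (simp add: bracket2_eq_0_iff_pt)
  qed
  ultimately show ?thesis unfolding parameters_equivalent_def using N' by blast
qed

text \<open>In parameters the dependence reads \<open>\<Sum> m\<^sub>i veronese (w\<^sub>i) \<otimes> u\<^sub>i = 0\<close>. Apply to the first factor
  the quadratic form that vanishes at \<open>w\<^sub>e\<close> and \<open>w\<^sub>c\<close>, and to the second the linear form that
  vanishes at \<open>u\<^sub>d\<close>: of the five summands only those of \<open>a\<close> and \<open>b\<close> survive. Doing the same with
  \<open>c\<close> and \<open>d\<close> interchanged gives two relations, from which the multipliers \<open>m\<^sub>a\<close> and \<open>m\<^sub>b\<close> can
  be eliminated because they are not zero.\<close>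

lemma kron_dependence_imp_same_cross_ratios:
  assumes k: "(\<Sum>i\<in>UNIV. k i *s kron (x i) (y i)) = 0" "\<And>i. k i \<noteq> 0"
  shows same_cross_ratios
  unfolding same_cross_ratios_def
proof (intro allI impI)
  fix a b c d :: 'i
  assume dist: "distinct [a, b, c, d]"
  obtain e where e: "distinct [a, b, c, d, e]" "UNIV = {a, b, c, d, e}"
    using fifth_index[OF five dist] by blast
  define m where "m i = k i * \<alpha> i * \<beta> i" for i
  have m_nz: "m i \<noteq> 0" for i using k(2) scalar_nz by (simp add: m_def)
  have "(\<Sum>i\<in>UNIV. k i *s kron (A' *v x i) (B' *v y i)) = 0"
    using k(1) by (rule kron_sum_matrix)
  then have "(\<Sum>i\<in>UNIV. m i *s kron (veronese (w i)) (u i)) = 0"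
    by (simp add: x_eq y_eq vec.scale kron_scale vector_smult_assoc m_def mult.assoc)
  then have S: "(\<Sum>i\<in>UNIV. m i * (veronese (w i) $ p * u i $ q)) = 0" for p q
    by (simp add: vec_eq_iff kron_def)
  have contract: "(\<Sum>i\<in>UNIV. m i * (bracket2 (w i) v * bracket2 (w i) v' * bracket2 (u i) z)) = 0"
    for v v' z
  proof -
    have "(\<Sum>i\<in>UNIV. m i * (bracket2 (w i) v * bracket2 (w i) v' * bracket2 (u i) z))
      = (\<Sum>i\<in>UNIV. v $ 2 * v' $ 2 * z $ 2 * (m i * (veronese (w i) $ 1 * u i $ 1))
          - v $ 2 * v' $ 2 * z $ 1 * (m i * (veronese (w i) $ 1 * u i $ 2))
          - (v $ 1 * v' $ 2 + v $ 2 * v' $ 1) * z $ 2 * (m i * (veronese (w i) $ 2 * u i $ 1))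
          + (v $ 1 * v' $ 2 + v $ 2 * v' $ 1) * z $ 1 * (m i * (veronese (w i) $ 2 * u i $ 2))
          + v $ 1 * v' $ 1 * z $ 2 * (m i * (veronese (w i) $ 3 * u i $ 1))
          - v $ 1 * v' $ 1 * z $ 1 * (m i * (veronese (w i) $ 3 * u i $ 2)))"
      by (intro sum.cong refl) (simp add: bracket2_expand power2_eq_square algebra_simps)
    also have "\<dots> = 0"
      by (simp only: sum.distrib sum_subtractf sum_distrib_left[symmetric] S) simp
    finally show ?thesis .
  qed
  have 1: "m a * bracket2 (w a) (w e) * (bracket2 (w a) (w c) * bracket2 (u a) (u d))
      = - (m b * bracket2 (w b) (w e) * (bracket2 (w b) (w c) * bracket2 (u b) (u d)))"
    using contract[of "w e" "w c" "u d"] e(1) unfolding e(2)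
    by (simp add: bracket2_expand[of "w c" "w c"] bracket2_expand[of "u d" "u d"]
        bracket2_expand[of "w e" "w e"] eq_neg_iff_add_eq_0 mult.assoc)
  have 2: "m a * bracket2 (w a) (w e) * (bracket2 (w a) (w d) * bracket2 (u a) (u c))
      = - (m b * bracket2 (w b) (w e) * (bracket2 (w b) (w d) * bracket2 (u b) (u c)))"
    using contract[of "w e" "w d" "u c"] e(1) unfolding e(2)
    by (simp add: bracket2_expand[of "w d" "w d"] bracket2_expand[of "u c" "u c"]
        bracket2_expand[of "w e" "w e"] eq_neg_iff_add_eq_0 mult.assoc)
  \<comment> \<open>Two relations with common unknowns \<open>P\<close> and \<open>R\<close> force their coefficient vectors to be
    proportional.\<close>
  have elim: "X1 * Y2 = X2 * Y1" if "P * X1 = - (R * Y1)" "P * X2 = - (R * Y2)" "P \<noteq> 0"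
    for P R X1 X2 Y1 Y2 :: complex
  proof -
    have "P * (X1 * Y2) = - (R * Y1) * Y2" using that(1) by (metis mult.assoc)
    also have "\<dots> = P * X2 * Y1" using that(2) by (simp add: algebra_simps)
    finally show ?thesis using that(3) by simp
  qed
  have "m a * bracket2 (w a) (w e) \<noteq> 0" using m_nz w_distinct[of a e] e(1) by simp
  from elim[OF 1 2 this]
  show "bracket2 (w a) (w c) * bracket2 (w b) (w d) * (bracket2 (u a) (u d) * bracket2 (u b) (u c))
    = bracket2 (u a) (u c) * bracket2 (u b) (u d) * (bracket2 (w a) (w d) * bracket2 (w b) (w c))"
    by (simp add: mult_ac)
qed

text \<open>The form \<open>bracket2 (T p) (T q)\<close> is alternating and vanishes when \<open>p\<close> or \<open>q\<close> is the center,
  hence it is a constant multiple of the determinant of center, \<open>p\<close> and \<open>q\<close>. On the conic this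
  determinant is \<open>bracket2 w w'\<close> times a constant and one factor for each of the two points, and
  such factors cancel in cross-ratios.\<close>

lemma projection_imp_same_cross_ratios:
  assumes c: "c \<in> \<omega>" "c \<notin> range (\<lambda>i. pt (x i))"
    and T: "centered_at c T" "\<And>i. \<iota> (pt (T *v x i)) = pt (y i)"
  shows same_cross_ratios
proof -
  obtain v where v: "v \<noteq> 0" "c = pt v" and ker: "{w. T *v w = 0} = vec.span {v}"
    using T(1) unfolding centered_at_def by blast
  obtain z where z: "z \<noteq> 0" "c = conic_pt z" using c(1) by (rule conic_cases)
  then obtain h where h: "h \<noteq> 0" "v = h *s (A *v veronese z)"
    using v pt_eq_iff[of "A *v veronese z" v] by (auto simp: conic_pt_def)
  have Tx_nz: "T *v x i \<noteq> 0" for i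
  proof
    assume "T *v x i = 0"
    then have "x i \<in> vec.span {v}" using ker by blast
    then obtain k where k: "x i = k *s v" by (auto simp: vec.span_singleton)
    moreover have "x i \<noteq> 0" using scalar_nz param_nz by (simp add: x_eq)
    ultimately have "pt (x i) = c" using v by (auto simp: pt_scale)
    then show False using c(2) by auto
  qed
  have "\<exists>k. k \<noteq> 0 \<and> T *v x i = k *s u i" for i
  proof -
    have "pt (u i) = pt (T *v x i)"
      using T(2)[of i] Tx_nz param_nz by (simp add: pt_y ident_eq_iff)
    then show ?thesis using pt_eq_iff[of "u i" "T *v x i"] Tx_nz param_nz by simp
  qed
  then obtain \<mu> where \<mu>: "\<mu> i \<noteq> 0" "T *v x i = \<mu> i *s u i" for i by metis
  \<comment> \<open>The cross product of the rows of \<open>T\<close>, which represents the alternating form and lies in the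
    kernel.\<close>
  define n :: "complex^3" where
    "n = vector [T $ 1 $ 2 * T $ 2 $ 3 - T $ 1 $ 3 * T $ 2 $ 2,
                 T $ 1 $ 3 * T $ 2 $ 1 - T $ 1 $ 1 * T $ 2 $ 3,
                 T $ 1 $ 1 * T $ 2 $ 2 - T $ 1 $ 2 * T $ 2 $ 1]"
  have "T *v n = 0"
    by (simp add: n_def matrix_vector_mult_def vec_eq_iff forall_2 sum_3 algebra_simps)
  then have "n \<in> vec.span {v}" using ker by blast
  then obtain k where k: "n = k *s v" by (auto simp: vec.span_singleton)
  have Tpq: "bracket2 (T *v p) (T *v q) = k * bracket3 v p q" for p q
  proof -
    have "bracket2 (T *v p) (T *v q) = bracket3 n p q"
      by (simp add: n_def bracket2_expand bracket3_def det_3 matrix_vector_mult_def sum_3 algebra_simps)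
    then show ?thesis by (simp add: k bracket3_scale)
  qed
  define g where "g i = \<alpha> i * bracket2 z (w i) / \<mu> i" for i
  have u: "bracket2 (u i) (u j) = k * h * det A * (g i * g j * bracket2 (w i) (w j))" for i j
  proof -
    have "\<mu> i * \<mu> j * bracket2 (u i) (u j) = bracket2 (T *v x i) (T *v x j)"
      by (simp add: \<mu> bracket2_scale)
    also have "\<dots> = k * h * \<alpha> i * \<alpha> j * det A * (bracket2 z (w i) * bracket2 z (w j) * bracket2 (w i) (w j))"
      by (simp add: Tpq h x_eq bracket3_scale bracket3_conic)
    finally show ?thesis using \<mu>(1)[of i] \<mu>(1)[of j] by (simp add: g_def field_simps)
  qed
  show ?thesis unfolding same_cross_ratios_def u by (simp add: mult_ac)
qed

lemma isomorphism_imp_same_cross_ratios: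
  assumes F: "cross_ratio_preserving \<omega> \<iota> F" "\<And>i. F (pt (x i)) = pt (y i)"
  shows same_cross_ratios
  unfolding same_cross_ratios_def
proof (intro allI impI)
  fix a b c d :: 'i
  assume dist: "distinct [a, b, c, d]"
  have F_inv: "inv \<iota> (F (conic_pt (w i))) = pt (u i)" for i
    using F(2)[of i] by (simp add: pt_x pt_y inv_f_f[OF inj_ident])
  have ne: "conic_pt (w i) \<noteq> conic_pt (w j)" if "i \<noteq> j" for i j
    using that w_distinct[of i j] param_nz by (simp add: bracket2_eq_0_iff_pt conic_pt_eq_iff)
  have nz: "bracket2 (w a) (w d) \<noteq> 0" "bracket2 (w b) (w c) \<noteq> 0"
    "bracket2 (u a) (u d) \<noteq> 0" "bracket2 (u b) (u c) \<noteq> 0"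
    using dist w_distinct u_distinct by auto
  have "distinct [conic_pt (w a), conic_pt (w b), conic_pt (w c), conic_pt (w d)]"
    using dist ne by simp
  then have "conic_cross_ratio \<omega> (conic_pt (w a)) (conic_pt (w b)) (conic_pt (w c)) (conic_pt (w d))
      = cross_ratio (pt (u a)) (pt (u b)) (pt (u c)) (pt (u d))"
    using F(1) conic_pt_in param_nz unfolding cross_ratio_preserving_def F_inv[symmetric] by blast
  then show "bracket2 (w a) (w c) * bracket2 (w b) (w d) * (bracket2 (u a) (u d) * bracket2 (u b) (u c))
    = bracket2 (u a) (u c) * bracket2 (u b) (u d) * (bracket2 (w a) (w d) * bracket2 (w b) (w c))"
    using nz param_nz by (simp add: conic_cross_ratio_conic_pt cross_ratio_pt frac_eq_eq)
qed

text \<open>If \<open>u\<^sub>i\<close> is proportional to \<open>N w\<^sub>i\<close>, then a linear map takes \<open>veronese (w\<^sub>i) \<otimes> w\<^sub>i\<close> to a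
  multiple of \<open>x\<^sub>i \<otimes> y\<^sub>i\<close>. The entries of \<open>veronese (w\<^sub>i) \<otimes> w\<^sub>i\<close> are binary cubic monomials,
  which span a space of dimension four, so five such vectors are dependent. The vectors \<open>w \<otimes>
  (s\<^sup>2, t\<^sup>2)\<close> with \<open>w = (s, t)\<close> list each of the four monomials once.\<close>

lemma equivalent_imp_kron_dependence:
  assumes parameters_equivalent
  obtains k where "\<exists>i. k i \<noteq> 0" "(\<Sum>i\<in>UNIV. k i *s kron (x i) (y i)) = 0"
proof -
  obtain N :: "complex^2^2" where N: "pt (N *v w i) = pt (u i)" and N_nz: "N *v w i \<noteq> 0" for i
    using assms param_nz unfolding parameters_equivalent_def
    by (metis matrix_left_invertible_ker)
  have "\<exists>k. k \<noteq> 0 \<and> u i = k *s (N *v w i)" for i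
    using pt_eq_iff[OF N_nz param_nz(2)] N by blast
  then obtain \<mu> where \<mu>: "\<mu> i \<noteq> 0" "u i = \<mu> i *s (N *v w i)" for i by metis
  have "CARD(2 \<times> 2) < CARD('i)" by (simp add: five)
  then obtain m where m: "\<exists>i. m i \<noteq> 0"
    "(\<Sum>i\<in>UNIV. m i *s kron (w i) (vector [w i $ 1 ^ 2, w i $ 2 ^ 2] :: complex^2)) = 0"
    using linear_dependence_exists[of "\<lambda>i. kron (w i) (vector [w i $ 1 ^ 2, w i $ 2 ^ 2] :: complex^2)"]
    by blast
  have "(\<Sum>i\<in>UNIV. m i * (w i $ p * (vector [w i $ 1 ^ 2, w i $ 2 ^ 2] :: complex^2) $ q)) = 0" for p q
    using m(2) by (simp add: vec_eq_iff kron_def)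
  from this[of 1 1] this[of 1 2] this[of 2 1] this[of 2 2]
  have "(\<Sum>i\<in>UNIV. m i *s kron (veronese (w i)) (w i)) = 0"
    by (simp add: vec_eq_iff kron_def forall_2 forall_3 power2_eq_square mult_ac)
  then have 0: "(\<Sum>i\<in>UNIV. m i *s kron (A *v veronese (w i)) ((B ** N) *v w i)) = 0"
    by (rule kron_sum_matrix)
  define k where "k i = m i / (\<alpha> i * \<beta> i * \<mu> i)" for i
  have "k i *s kron (x i) (y i) = m i *s kron (A *v veronese (w i)) ((B ** N) *v w i)" for i
  proof -
    have "y i = (\<beta> i * \<mu> i) *s ((B ** N) *v w i)"
      by (simp add: y_eq \<mu>(2) vec.scale vector_smult_assoc matrix_vector_mul_assoc)
    then show ?thesis
      using scalar_nz \<mu>(1) by (simp add: x_eq kron_scale vector_smult_assoc k_def)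
  qed
  then have "(\<Sum>i\<in>UNIV. k i *s kron (x i) (y i)) = 0" using 0 by simp
  moreover have "\<exists>i. k i \<noteq> 0" using m(1) scalar_nz \<mu>(1) by (simp add: k_def)
  ultimately show thesis using that by blast
qed

text \<open>Let \<open>z\<close> be the parameter of the center. The matrix \<open>S\<close> kills \<open>veronese z\<close> and maps \<open>veronese
  w\<close> to the multiple \<open>bracket2 w z\<close> of \<open>w\<close>, so it is the projection of the conic from that
  point, read off in parameters; composing it with \<open>N\<close> yields the required transformation.\<close>

lemma equivalent_imp_projection:
  assumes parameters_equivalent and c: "c \<in> \<omega>" "c \<notin> range (\<lambda>i. pt (x i))"
  obtains T where "centered_at c T" "\<And>i. \<iota> (pt (T *v x i)) = pt (y i)"
proof -
  obtain N N' :: "complex^2^2" where N: "\<And>i. pt (N *v w i) = pt (u i)"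
    and N': "N ** N' = mat 1" "N' ** N = mat 1"
    using assms(1) unfolding parameters_equivalent_def by blast
  have N_cancel [simp]: "N' *v (N *v v) = v" for v by (simp add: matrix_vector_mul_assoc N')
  have N_0 [simp]: "N *v v = 0 \<longleftrightarrow> v = 0" for v by (metis N_cancel matrix_vector_mult_0_right)
  obtain z where z: "z \<noteq> 0" "c = conic_pt z" using c(1) by (rule conic_cases)
  define S :: "complex^3^2" where "S = vector [vector [z $ 2, - z $ 1, 0], vector [0, z $ 2, - z $ 1]]"
  have S: "S *v veronese v = bracket2 v z *s v" for v
    by (simp add: S_def matrix_vector_mult_def vec_eq_iff forall_2 sum_3 bracket2_expand
        power2_eq_square algebra_simps)
  have S_ker: "S *v t = 0 \<longleftrightarrow> (\<exists>k. t = k *s veronese z)" for t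
  proof
    assume "S *v t = 0"
    then have t: "z $ 2 * t $ 1 = z $ 1 * t $ 2" "z $ 2 * t $ 2 = z $ 1 * t $ 3"
      by (simp_all add: S_def matrix_vector_mult_def vec_eq_iff forall_2 sum_3)
    show "\<exists>k. t = k *s veronese z"
    proof (cases "z $ 1 = 0")
      case True
      then have "z $ 2 \<noteq> 0" using z by (simp add: vec2_eq_0_iff)
      then show ?thesis using t True
        by (intro exI[of _ "t $ 3 / z $ 2 ^ 2"]) (simp add: vec_eq_iff forall_3)
    next
      case False
      then have "t $ 2 = z $ 2 * t $ 1 / z $ 1" "t $ 3 = z $ 2 * t $ 2 / z $ 1"
        using t by (simp_all add: field_simps)
      then show ?thesis using False
        by (intro exI[of _ "t $ 1 / z $ 1 ^ 2"]) (simp add: vec_eq_iff forall_3 power2_eq_square)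
    qed
  next
    assume "\<exists>k. t = k *s veronese z"
    then show "S *v t = 0" by (auto simp: vec.scale S) (simp add: bracket2_expand)
  qed
  define T where "T = N ** S ** A'"
  have T: "T *v v = N *v (S *v (A' *v v))" for v
    by (simp add: T_def matrix_vector_mul_assoc matrix_mul_assoc)
  have "{v. T *v v = 0} = vec.span {A *v veronese z}"
  proof -
    have "T *v v = 0 \<longleftrightarrow> (\<exists>k. v = k *s (A *v veronese z))" for v
    proof -
      have "A' *v v = k *s veronese z \<longleftrightarrow> v = k *s (A *v veronese z)" for k
        by (metis A_cancel vec.scale)
      then show ?thesis by (simp add: T S_ker)
    qed
    then show ?thesis by (auto simp: vec.span_singleton)
  qed
  moreover have "rank T = 2"
  proof -
    have "l i = 0" if l: "(\<Sum>j\<in>UNIV. l j *s row j T) = 0" for l i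
    proof -
      \<comment> \<open>A linear form that vanishes on the image of \<open>T\<close> pulls back along \<open>N\<close> to one that vanishes
        on the image of \<open>S\<close>.\<close>
      define l' where "l' = (\<chi> j. l j)"
      have "transpose T *v l' = 0"
        using l
          by (simp add: l'_def vec_eq_iff matrix_vector_mult_def transpose_def row_def mult.commute)
      then have "(\<Sum>j\<in>UNIV. (T *v v) $ j * l' $ j) = 0" for v
        by (simp add: dot_matrix_vector_mult)
      from this[of "A *v v" for v] have "(\<Sum>j\<in>UNIV. (N *v (S *v v)) $ j * l' $ j) = 0" for v
        by (simp add: T)
      then have r: "(\<Sum>j\<in>UNIV. (S *v v) $ j * (transpose N *v l') $ j) = 0" for v
        by (simp add: dot_matrix_vector_mult[of N])
      define r where "r = transpose N *v l'"
      have "z $ 2 * r $ 1 = 0" "z $ 2 * r $ 2 = z $ 1 * r $ 1" "z $ 1 * r $ 2 = 0"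
        using r[of "vector [1, 0, 0]"] r[of "vector [0, 1, 0]"] r[of "vector [0, 0, 1]"]
        unfolding r_def[symmetric]
        by (simp_all add: S_def matrix_vector_mult_def sum_2 sum_3)
      then have "r = 0" using z(1) by (auto simp: vec2_eq_0_iff)
      have "l' = transpose (N ** N') *v l'" by (simp add: N')
      also have "\<dots> = transpose N' *v r"
        by (simp only: matrix_transpose_mul r_def matrix_vector_mul_assoc)
      also have "\<dots> = 0" by (simp add: \<open>r = 0\<close>)
      finally show ?thesis by (simp add: l'_def vec_eq_iff)
    qed
    then have "\<not> rank T < CARD(2)" unfolding rank_less_iff_rows_dependent by blast
    then show ?thesis using rank_le_card_rows[of T] by simp
  qed
  ultimately have "centered_at c T"
    unfolding centered_at_def using z
      by (intro conjI exI[of _ "A *v veronese z"]) (auto simp: conic_pt_def)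
  moreover have "\<iota> (pt (T *v x i)) = pt (y i)" for i
  proof -
    have "conic_pt (w i) \<noteq> c" using c(2) pt_x by (metis rangeI)
    then have nz: "bracket2 (w i) z \<noteq> 0"
      using z param_nz by (simp add: bracket2_eq_0_iff_pt conic_pt_eq_iff)
    have "T *v x i = (\<alpha> i * bracket2 (w i) z) *s (N *v w i)"
      by (simp add: T x_eq vec.scale S vector_smult_assoc)
    then have "pt (T *v x i) = pt (u i)"
      using nz scalar_nz param_nz N by (simp add: pt_scale)
    then show ?thesis by (simp add: pt_y)
  qed
  ultimately show thesis by (rule that)
qed

lemma equivalent_imp_isomorphism:
  assumes parameters_equivalent
  obtains F where "proj_isomorphism \<omega> L F" "cross_ratio_preserving \<omega> \<iota> F"
    "\<And>i. F (pt (x i)) = pt (y i)"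
proof -
  obtain N N' :: "complex^2^2" where N: "\<And>i. pt (N *v w i) = pt (u i)"
    and N': "N ** N' = mat 1" "N' ** N = mat 1"
    using assms(1) unfolding parameters_equivalent_def by blast
  obtain F where F: "proj_isomorphism \<omega> L F" "cross_ratio_preserving \<omega> \<iota> F"
    "\<And>w. w \<noteq> 0 \<Longrightarrow> F (conic_pt w) = \<iota> (pt (N *v w))"
    using isomorphism_from_matrix[OF N'] by blast
  have "F (pt (x i)) = pt (y i)" for i
    using param_nz by (simp add: pt_x pt_y F(3) N)
  with F(1,2) show thesis by (rule that)
qed

end

section \<open>The equivalence theorem\<close>

lemma rank_Z_matrix_iff:
  fixes x y :: "'i::finite \<Rightarrow> complex^3"
  shows "rank (Z_matrix x y) < CARD('i) \<longleftrightarrow>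
    (\<exists>k. (\<exists>i. k i \<noteq> 0) \<and> (\<Sum>i\<in>UNIV. k i *s kron (x i) (y i)) = 0)"
  by (simp add: rank_less_iff_rows_dependent Z_matrix_def row_def)

text \<open>A nontrivial dependence with a vanishing coefficient is one among the rows of a proper subset.\<close>

lemma dependence_full_support:
  fixes x y :: "'i::finite \<Rightarrow> complex^3"
  assumes "\<not> inherited_condition (Z_matrix x y)"
    and "(\<Sum>i\<in>UNIV. k i *s kron (x i) (y i)) = 0" "k j \<noteq> 0"
  shows "k i \<noteq> 0"
proof
  assume "k i = 0"
  then have "(\<Sum>l\<in>UNIV - {i}. k l *s row l (Z_matrix x y)) = 0"
    using assms(2) by (simp add: sum.remove[of UNIV i] Z_matrix_def row_def)
  moreover have "j \<in> UNIV - {i}" using \<open>k i = 0\<close> assms(3) by auto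
  ultimately show False using assms(1,3) unfolding inherited_condition_def by blast
qed

theorem theorem5p2:
  fixes x y :: "5 \<Rightarrow> complex^3"
    and \<omega> L :: "3 proj set"
    and \<iota> :: "2 proj \<Rightarrow> 3 proj"
  assumes "\<And>i. x i \<noteq> 0" and "\<And>i. y i \<noteq> 0"
    and "\<And>i j k. distinct [i, j, k] \<Longrightarrow> \<not> proj_collinear {pt (x i), pt (x j), pt (x k)}"
    and "inj (\<lambda>i. pt (y i))"
    and "is_line L" and "\<And>i. pt (y i) \<in> L"
    and "line_identification L \<iota>"
    and "is_conic \<omega>" and "\<And>i. pt (x i) \<in> \<omega>"
    and "\<not> inherited_condition (Z_matrix x y)"
  shows
    "(rank (Z_matrix x y) < 5 \<longleftrightarrow>
        (\<forall>c \<in> \<omega> - range (\<lambda>i. pt (x i)).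
           \<exists>T. centered_at c T \<and> (\<forall>i. \<iota> (pt (T *v x i)) = pt (y i)))) \<and>
     (rank (Z_matrix x y) < 5 \<longleftrightarrow>
        (\<exists>c \<in> \<omega> - range (\<lambda>i. pt (x i)).
           \<exists>T. centered_at c T \<and> (\<forall>i. \<iota> (pt (T *v x i)) = pt (y i)))) \<and>
     (rank (Z_matrix x y) < 5 \<longleftrightarrow>
        (\<exists>F. proj_isomorphism \<omega> L F \<and> cross_ratio_preserving \<omega> \<iota> F \<and>
             (\<forall>i. F (pt (x i)) = pt (y i))))"
proof -
  have nz: "bracket3 (x i) (x j) (x k) \<noteq> 0" if "distinct [i, j, k]" for i j k
    using assms(3)[OF that] collinear_if_bracket3_eq_0 assms(1) by blast
  obtain A A' :: "complex^3^3" where A: "A ** A' = mat 1" "A' ** A = mat 1"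
    "\<omega> = {pt (A *v veronese w) |w. w \<noteq> 0}"
    by (rule conic_parametrization[OF assms(8), of "x 1" "x 2" "x 3" "x 4" "x 5"])
      (auto intro!: nz assms(9))
  obtain B :: "complex^2^3" where B: "rank B = CARD(2)" "\<And>u. u \<noteq> 0 \<Longrightarrow> \<iota> (pt u) = pt (B *v u)"
    and range: "range \<iota> = L"
    using assms(7) unfolding line_identification_def by auto
  obtain B' where B': "B' ** B = mat 1" using B(1) by (rule full_column_rank_left_inverse)
  interpret P: parametrized_conic_and_line A A' B B' \<omega> L \<iota>
    by unfold_locales (use A B' B(2) range in auto)
  have "\<exists>w a. w \<noteq> 0 \<and> a \<noteq> 0 \<and> x i = a *s (A *v veronese w)" for i
  proof -
    obtain w where w: "w \<noteq> 0" "pt (x i) = P.conic_pt w" using assms(9) by (rule P.conic_cases)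
    then show ?thesis
      using pt_eq_iff[of "A *v veronese w" "x i"] assms(1) by (auto simp: P.conic_pt_def)
  qed
  then obtain w \<alpha> where w: "\<And>i. w i \<noteq> 0" "\<And>i. \<alpha> i \<noteq> 0" "\<And>i. x i = \<alpha> i *s (A *v veronese (w i))"
    by metis
  have "\<exists>u b. u \<noteq> 0 \<and> b \<noteq> 0 \<and> y i = b *s (B *v u)" for i
  proof -
    obtain u where u: "u \<noteq> 0" "pt (y i) = \<iota> (pt u)" using assms(6) by (rule P.line_cases)
    then show ?thesis using pt_eq_iff[of "B *v u" "y i"] assms(2) by (auto simp: P.ident)
  qed
  then obtain u \<beta> where u: "\<And>i. u i \<noteq> 0" "\<And>i. \<beta> i \<noteq> 0" "\<And>i. y i = \<beta> i *s (B *v u i)"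
    by metis
  have w_distinct: "bracket2 (w i) (w j) \<noteq> 0" if ij: "i \<noteq> j" for i j
  proof
    assume 0: "bracket2 (w i) (w j) = 0"
    have "card (UNIV - {i, j} :: 5 set) = 3" using ij by (simp add: card_Diff_subset)
    then obtain l where "l \<in> UNIV - {i, j}" by (metis all_not_in_conv card.empty zero_neq_numeral)
    then have "bracket3 (x i) (x j) (x l) \<noteq> 0" using ij by (intro nz) auto
    then show False using 0 by (simp add: w(3) bracket3_scale P.bracket3_conic)
  qed
  have u_distinct: "bracket2 (u i) (u j) \<noteq> 0" if ij: "i \<noteq> j" for i j
  proof -
    have "pt (y i) \<noteq> pt (y j)" using assms(4) ij by (auto dest: injD)
    moreover have "pt (y i) = pt (B *v u i)" for i using u by (simp add: pt_scale)
    ultimately have "pt (u i) \<noteq> pt (u j)" using P.ident u(1) by metis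
    then show ?thesis using u(1) by (simp add: bracket2_eq_0_iff_pt)
  qed
  interpret conic_line_configuration A A' B B' \<omega> L \<iota> x y w u \<alpha> \<beta>
    by unfold_locales (use w u w_distinct u_distinct in auto)
  have rank: "rank (Z_matrix x y) < 5 \<longleftrightarrow> parameters_equivalent"
  proof
    assume "rank (Z_matrix x y) < 5"
    then obtain k j where k: "(\<Sum>i\<in>UNIV. k i *s kron (x i) (y i)) = 0" "k j \<noteq> 0"
      using rank_Z_matrix_iff[of x y] by auto
    then have "k i \<noteq> 0" for i using dependence_full_support[OF assms(10)] by blast
    with k(1) show parameters_equivalent
      by (intro same_cross_ratios_imp_equivalent kron_dependence_imp_same_cross_ratios)
  next
    assume parameters_equivalent
    then show "rank (Z_matrix x y) < 5"
      using rank_Z_matrix_iff[of x y] by (auto elim!: equivalent_imp_kron_dependence)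
  qed
  let ?proj = "\<lambda>c. \<exists>T. centered_at c T \<and> (\<forall>i. \<iota> (pt (T *v x i)) = pt (y i))"
  let ?D = "\<omega> - range (\<lambda>i. pt (x i))"
  have all: "?proj c" if "parameters_equivalent" "c \<in> ?D" for c
    using that equivalent_imp_projection[of c] by (metis DiffE)
  have ex: parameters_equivalent if "c \<in> ?D" "?proj c" for c
    using that projection_imp_same_cross_ratios same_cross_ratios_imp_equivalent by (metis DiffE)
  have "?D \<noteq> {}"
    using P.infinite_conic
      by (metis Diff_infinite_finite finite.emptyI finite_imageI finite_class.finite_UNIV)
  then have 23: "parameters_equivalent \<longleftrightarrow> (\<forall>c\<in>?D. ?proj c)" "parameters_equivalent \<longleftrightarrow> (\<exists>c\<in>?D. ?proj c)"
    using all ex by blast+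
  have 4: "parameters_equivalent \<longleftrightarrow> (\<exists>F. proj_isomorphism \<omega> L F \<and> cross_ratio_preserving \<omega> \<iota> F \<and>
             (\<forall>i. F (pt (x i)) = pt (y i)))"
    using equivalent_imp_isomorphism isomorphism_imp_same_cross_ratios
      same_cross_ratios_imp_equivalent by metis
  show ?thesis unfolding rank using 23 4 by blast
qed

end
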